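(* Let $\theta$ be a Blaschke product of order $n$, let $v_1, \dots, v_n$ be a $C_{\theta}$-real basis for $K_{\theta}$ and let $\lambda_1, \dots , \lambda_{2n-1}$ be distinct points in $\mathbb{D}$. Let $S=(s_{ij})$ be a symmetric $n\times n$ matrix with complex entries. Then $S$ is the matrix representation of some truncated Toeplitz operator on $K_{\theta}$ with respect to the basis $v_1, \dots, v_n$ if and only if $$\ker\, [c_1 , c_2, \dots , c_{2n-1}, V(S)] \neq \{ 0 \},$$ where, for $l = 1,\dots,2n-1$, $c_l = V\big((a^l_{ij})\big)$ is the vectorialisation of the symmetric $n \times n$ matrix with $(i,j)$ entry $a_{ij}^l= \overline{v_i(\lambda_l) v_j(\lambda_l)}$, and $[c_1,\dots,c_{2n-1},V(S)]$ denotes the $\frac{n(n+1)}{2}\times 2n$ matrix with these columns.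
   Context: $\mathbb{D}$ is the open unit disc in $\mathbb{C}$ and $\mathbb{T}$ the unit circle. $H^2$ is the Hardy space of the disc, viewed via radial boundary values as a closed subspace of $L^2(\mathbb{T})$ (normalized Lebesgue measure; inner product linear in the first variable). A finite Blaschke product $\theta$ has order $n\in\mathbb{N}$ if it has $n$ zeros in $\mathbb{D}$ counted with multiplicity. The model space is $K_\theta = H^2 \ominus \theta H^2$; for $\theta$ a finite Blaschke product of order $n$ it has dimension $n$. The canonical conjugation on $K_\theta$ is the antilinear isometric involution $C_\theta f = \theta\,\overline{z f}$ (functions on $\mathbb{T}$). A $C_\theta$-real basis for $K_\theta$ is an orthonormal basis $v_1,\dots,v_n$ of $K_\theta$ with $C_\theta v_j = v_j$ for all $j$. A truncated Toeplitz operator (TTO) on $K_\theta$ is an operator of the form $A_\phi f = P_\theta(\phi f)$, $f \in K_\theta$, for some $\phi\in L^\infty(\mathbb{T})$, where $P_\theta: L^2(\mathbb{T})\to K_\theta$ is the orthogonal projection. The matrix representation of an operator $A$ on $K_\theta$ with respect to $v_1,\dots,v_n$ has $(i,j)$ entry $\langle A v_j, v_i\rangle$. Vectorialisation: let $S_n(\mathbb{C})$ be the space of symmetric $n\times n$ complex matrices. $V: S_n(\mathbb{C})\to\mathbb{C}^{n(n+1)/2}$ sends $M=(a_{ij})$ to the column vector listing the entries on and above the diagonal row by row: $V(M) = (a_{11}, a_{12},\dots,a_{1n},a_{22},a_{23},\dots,a_{2n},a_{33},\dots,a_{3n},\dots,a_{(n-1)(n-1)},a_{(n-1)n},a_{nn})^T$.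 *)

theory Defs
  imports "HOL-Analysis.Analysis" "Jordan_Normal_Form.Matrix_Kernel"
begin

section \<open>Function spaces on the circle\<close>

text \<open>
  Elements of \<open>L\<^sup>2(\<T>)\<close> and \<open>L\<^sup>\<infinity>(\<T>)\<close> are represented by functions
  \<^typ>\<open>complex \<Rightarrow> complex\<close>, of which only the values on the unit circle matter; equality in these
  spaces is equality almost everywhere with respect to the following measure, which lives on
  \<open>sphere 0 1\<close> and is the normalized Lebesgue measure there.
\<close>

definition circle_measure :: "complex measure" where
  "circle_measure =
     distr (uniform_measure lborel {0..2 * pi}) (restrict_space borel (sphere 0 1)) cis"

definition L2_circle :: "(complex \<Rightarrow> complex) set" where
  "L2_circle = {f \<in> borel_measurable circle_measure. integrable circle_measure (\<lambda>z. (norm (f z))\<^sup>2)}"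

definition Linf_circle :: "(complex \<Rightarrow> complex) set" where
  "Linf_circle = {f \<in> borel_measurable circle_measure. \<exists>B. AE z in circle_measure. norm (f z) \<le> B}"

definition L2_inner :: "(complex \<Rightarrow> complex) \<Rightarrow> (complex \<Rightarrow> complex) \<Rightarrow> complex" where
  "L2_inner f g = (LINT z|circle_measure. f z * cnj (g z))"

text \<open>
  An element of \<open>H\<^sup>2\<close> is represented by one function on the closed disc that carries both views of
  it: on \<open>ball 0 1\<close> it is the holomorphic function, with bounded square means over the circles of
  radius \<open>r < 1\<close>, and on \<open>sphere 0 1\<close> it is (a representative of) the radial boundary function in
  \<open>L\<^sup>2(\<T>)\<close>.  Values outside the closed disc are irrelevant.
\<close>

definition hardy2 :: "(complex \<Rightarrow> complex) set" where
  "hardy2 = {f \<in> L2_circle.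
     f holomorphic_on ball 0 1 \<and>
     (\<exists>B. \<forall>r\<in>{0..<1::real}. (LINT z|circle_measure. (norm (f (of_real r * z)))\<^sup>2) \<le> B) \<and>
     (AE z in circle_measure. ((\<lambda>r::real. f (of_real r * z)) \<longlongrightarrow> f z) (at_left 1))}"

section \<open>Model spaces and truncated Toeplitz operators\<close>

definition blaschke_product :: "nat \<Rightarrow> (complex \<Rightarrow> complex) \<Rightarrow> bool" where
  "blaschke_product n \<theta> \<longleftrightarrow>
     (\<exists>c a. norm c = 1 \<and> (\<forall>k<n. a k \<in> ball 0 1) \<and>
        (\<forall>z\<in>cball 0 1. \<theta> z = c * (\<Prod>k<n. (z - a k) / (1 - cnj (a k) * z))))"

definition model_space :: "(complex \<Rightarrow> complex) \<Rightarrow> (complex \<Rightarrow> complex) set" where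
  "model_space \<theta> = {f \<in> hardy2. \<forall>g\<in>hardy2. L2_inner f (\<lambda>z. \<theta> z * g z) = 0}"

text \<open>The canonical conjugation; the formula is meant on the circle only.\<close>

definition model_conj :: "(complex \<Rightarrow> complex) \<Rightarrow> (complex \<Rightarrow> complex) \<Rightarrow> complex \<Rightarrow> complex" where
  "model_conj \<theta> f = (\<lambda>z. \<theta> z * cnj (z * f z))"

definition model_onb :: "nat \<Rightarrow> (complex \<Rightarrow> complex) \<Rightarrow> (nat \<Rightarrow> complex \<Rightarrow> complex) \<Rightarrow> bool" where
  "model_onb n \<theta> v \<longleftrightarrow>
     (\<forall>i<n. v i \<in> model_space \<theta>) \<and>
     (\<forall>i<n. \<forall>j<n. L2_inner (v i) (v j) = (if i = j then 1 else 0)) \<and>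
     (\<forall>f\<in>model_space \<theta>. \<exists>c. AE z in circle_measure. f z = (\<Sum>j<n. c j * v j z))"

definition conj_real_basis :: "nat \<Rightarrow> (complex \<Rightarrow> complex) \<Rightarrow> (nat \<Rightarrow> complex \<Rightarrow> complex) \<Rightarrow> bool" where
  "conj_real_basis n \<theta> v \<longleftrightarrow>
     model_onb n \<theta> v \<and> (\<forall>j<n. AE z in circle_measure. model_conj \<theta> (v j) z = v j z)"

text \<open>
  \<open>is_model_proj \<theta> g h\<close> says that \<open>h\<close> represents the orthogonal projection \<open>P\<^sub>\<theta> g\<close>. The projection
  is given as a relation because it determines \<open>h\<close> only up to the choice of representative.
\<close>

definition is_model_proj ::
    "(complex \<Rightarrow> complex) \<Rightarrow> (complex \<Rightarrow> complex) \<Rightarrow> (complex \<Rightarrow> complex) \<Rightarrow> bool" where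
  "is_model_proj \<theta> g h \<longleftrightarrow>
     h \<in> model_space \<theta> \<and> (\<forall>k\<in>model_space \<theta>. L2_inner (\<lambda>z. g z - h z) k = 0)"

definition truncated_toeplitz ::
    "(complex \<Rightarrow> complex) \<Rightarrow> ((complex \<Rightarrow> complex) \<Rightarrow> (complex \<Rightarrow> complex)) \<Rightarrow> bool" where
  "truncated_toeplitz \<theta> A \<longleftrightarrow>
     (\<exists>\<phi>\<in>Linf_circle. \<forall>f\<in>model_space \<theta>. is_model_proj \<theta> (\<lambda>z. \<phi> z * f z) (A f))"

section \<open>Matrices\<close>

text \<open>All indices are shifted to start at 0.\<close>

definition matrix_rep ::
    "nat \<Rightarrow> (nat \<Rightarrow> complex \<Rightarrow> complex) \<Rightarrow> ((complex \<Rightarrow> complex) \<Rightarrow> (complex \<Rightarrow> complex)) \<Rightarrow> complex mat"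
  where "matrix_rep n v A = Matrix.mat n n (\<lambda>(i, j). L2_inner (A (v j)) (v i))"

definition vectorialise :: "complex mat \<Rightarrow> complex Matrix.vec" where
  "vectorialise M =
     vec_of_list (concat (map (\<lambda>i. map (\<lambda>j. M $$ (i, j)) [i..<dim_col M]) [0..<dim_row M]))"

definition eval_matrix :: "nat \<Rightarrow> (nat \<Rightarrow> complex \<Rightarrow> complex) \<Rightarrow> complex \<Rightarrow> complex mat" where
  "eval_matrix n v w = Matrix.mat n n (\<lambda>(i, j). cnj (v i w * v j w))"

end

theory Submission
  imports Defs
    "HOL-Complex_Analysis.Cauchy_Integral_Formula"
    "HOL-Computational_Algebra.Polynomial"
    "Jordan_Normal_Form.Determinant"
begin

text \<open>
  Everything rests on the behaviour of the products \<open>v i * v j\<close>.  Let \<open>q\<close> be the product of the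
  factors \<open>1 - cnj (a k) * z\<close> over the zeros \<open>a k\<close> of \<open>\<theta>\<close>.  The \<open>n\<close> functions \<open>z\<^sup>k / q\<close> with \<open>k < n\<close>
  are linearly independent members of the model space, and the space has an orthonormal basis of
  \<open>n\<close> elements; hence they span it, and every \<open>v i\<close> is a polynomial of degree below \<open>n\<close> divided by
  \<open>q\<close> (lemma \<open>v_eq_poly_div_denom\<close>).  So the products \<open>v i * v j\<close> span exactly the functions
  \<open>P / q\<^sup>2\<close> with \<open>P\<close> a polynomial of degree at most \<open>2 * n - 2\<close>.  On this space of dimension
  \<open>2 * n - 1\<close>, the evaluations at \<open>2 * n - 1\<close> distinct points form a basis of the linear functionals,
  by Lagrange interpolation (\<open>products_interpolation\<close>, \<open>evaluations_independent\<close>).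

  A truncated Toeplitz matrix is the conjugate of such a functional.  Indeed \<open>v j\<close> is fixed by the
  conjugation, so \<open>v j = \<theta> * cnj (z * v j)\<close> on the circle, and the entry
  \<open>\<langle>\<phi> v j, v i\<rangle>\<close> is the integral of \<open>\<phi> * \<theta> * cnj z\<close> against \<open>cnj (v i * v j)\<close>
  (\<open>symbol_entry\<close>).  It is therefore a combination of the numbers \<open>cnj (v i w * v j w)\<close> at the
  given points \<open>w\<close>, with coefficients independent of \<open>i\<close> and \<open>j\<close>.  Conversely, the
  Cauchy formula \<open>LINT f * z / (z - w) = f w\<close> produces for each \<open>w\<close> a bounded symbol whose matrix
  has the entries \<open>cnj (v i w * v j w)\<close>.  Thus the matrices of truncated Toeplitz operators are
  exactly the linear combinations of the evaluation matrices (\<open>symbol_iff_evaluations\<close>).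

  As the evaluation matrices are linearly independent, a nonzero vector in the kernel of the matrix
  \<open>[c\<^sub>1, \<dots>, V(S)]\<close> must have a nonzero last coordinate, so it exists if and only if \<open>S\<close> is such a
  combination.

  The analytic input is the Cauchy formula for functions of the Hardy space in terms of their radial
  boundary values (\<open>hardy2_Cauchy_formula\<close>).  It also shows that such a function is determined on
  the disc by its boundary values, which carries identities from the circle into the disc.
\<close>

section \<open>Square integrable functions on a finite measure space\<close>

lemma norm_add_square_le: "(norm (a + b))\<^sup>2 \<le> 2 * (norm a)\<^sup>2 + 2 * (norm (b :: complex))\<^sup>2"
proof -
  have "(norm (a + b))\<^sup>2 \<le> (norm a + norm b)\<^sup>2"
    by (intro power_mono norm_triangle_ineq) auto
  also have "\<dots> \<le> 2 * (norm a)\<^sup>2 + 2 * (norm b)\<^sup>2"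
    using sum_squares_bound[of "norm a" "norm b"] by (simp add: power2_sum)
  finally show ?thesis .
qed

lemma integrable_norm_add_square:
  fixes f g :: "'a \<Rightarrow> complex"
  assumes [measurable]: "f \<in> borel_measurable M" "g \<in> borel_measurable M"
    and "integrable M (\<lambda>x. (norm (f x))\<^sup>2)" "integrable M (\<lambda>x. (norm (g x))\<^sup>2)"
  shows "integrable M (\<lambda>x. (norm (f x + g x))\<^sup>2)"
proof (rule Bochner_Integration.integrable_bound)
  show "integrable M (\<lambda>x. 2 * (norm (f x))\<^sup>2 + 2 * (norm (g x))\<^sup>2)"
    using assms by simp
  show "AE x in M. norm ((norm (f x + g x))\<^sup>2) \<le> norm (2 * (norm (f x))\<^sup>2 + 2 * (norm (g x))\<^sup>2)"
    using norm_add_square_le by simp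
qed measurable

lemma LINT_norm_add_square_le:
  fixes f g :: "'a \<Rightarrow> complex"
  assumes [measurable]: "f \<in> borel_measurable M" "g \<in> borel_measurable M"
    and "integrable M (\<lambda>x. (norm (f x))\<^sup>2)" "integrable M (\<lambda>x. (norm (g x))\<^sup>2)"
  shows "(LINT x|M. (norm (f x + g x))\<^sup>2) \<le> 2 * (LINT x|M. (norm (f x))\<^sup>2) + 2 * (LINT x|M. (norm (g x))\<^sup>2)"
proof -
  have "(LINT x|M. (norm (f x + g x))\<^sup>2) \<le> (LINT x|M. 2 * (norm (f x))\<^sup>2 + 2 * (norm (g x))\<^sup>2)"
    using assms by (intro integral_mono integrable_norm_add_square norm_add_square_le) auto
  also have "\<dots> = 2 * (LINT x|M. (norm (f x))\<^sup>2) + 2 * (LINT x|M. (norm (g x))\<^sup>2)"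
    using assms by simp
  finally show ?thesis .
qed

lemma (in finite_measure) integrable_of_square_integrable:
  fixes f :: "'a \<Rightarrow> complex"
  assumes [measurable]: "f \<in> borel_measurable M" and "integrable M (\<lambda>x. (norm (f x))\<^sup>2)"
  shows "integrable M f"
proof (rule Bochner_Integration.integrable_bound)
  show "integrable M (\<lambda>x. 1 + (norm (f x))\<^sup>2)"
    using assms by simp
  have "norm z \<le> 1 + (norm z)\<^sup>2" for z :: complex
    using sum_squares_bound[of "norm z" 1] norm_ge_zero[of z] by (simp del: norm_ge_zero)
  then show "AE x in M. norm (f x) \<le> norm (1 + (norm (f x))\<^sup>2)"
    by (intro AE_I2) (smt (verit) real_norm_def)
qed measurable

lemma integrable_mult_of_square_integrable:
  fixes f g :: "'a \<Rightarrow> complex"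
  assumes [measurable]: "f \<in> borel_measurable M" "g \<in> borel_measurable M"
    and "integrable M (\<lambda>x. (norm (f x))\<^sup>2)" "integrable M (\<lambda>x. (norm (g x))\<^sup>2)"
  shows "integrable M (\<lambda>x. f x * g x)"
proof (rule Bochner_Integration.integrable_bound)
  show "integrable M (\<lambda>x. (norm (f x))\<^sup>2 + (norm (g x))\<^sup>2)"
    using assms by simp
  have "norm (a * b) \<le> (norm a)\<^sup>2 + (norm b)\<^sup>2" for a b :: complex
  proof -
    have "norm a * norm b \<ge> 0" by simp
    with sum_squares_bound[of "norm a" "norm b"] show ?thesis
      unfolding norm_mult by linarith
  qed
  then show "AE x in M. norm (f x * g x) \<le> norm ((norm (f x))\<^sup>2 + (norm (g x))\<^sup>2)"
    by (intro AE_I2) (smt (verit) real_norm_def)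
qed measurable

text \<open>
  A bound on the square means makes the sequence uniformly integrable, which upgrades pointwise
  convergence to convergence of the integrals: the part of \<open>norm (F k - f)\<close> below a level \<open>K\<close> is
  handled by dominated convergence, and the part above \<open>K\<close> is at most \<open>(norm (F k - f))\<^sup>2 / K\<close>.
\<close>
lemma (in finite_measure) LINT_tendsto_of_square_means_bounded:
  fixes F :: "nat \<Rightarrow> 'a \<Rightarrow> complex" and f :: "'a \<Rightarrow> complex"
  assumes F[measurable]: "\<And>k. F k \<in> borel_measurable M"
    and F2: "\<And>k. integrable M (\<lambda>x. (norm (F k x))\<^sup>2)"
    and bound: "\<And>k. (LINT x|M. (norm (F k x))\<^sup>2) \<le> B"
    and f[measurable]: "f \<in> borel_measurable M"
    and f2: "integrable M (\<lambda>x. (norm (f x))\<^sup>2)"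
    and lim: "AE x in M. (\<lambda>k. F k x) \<longlonglongrightarrow> f x"
  shows "(\<lambda>k. LINT x|M. F k x) \<longlonglongrightarrow> (LINT x|M. f x)"
proof -
  define G where "G = (\<lambda>k x. norm (F k x - f x))"
  have [measurable]: "G k \<in> borel_measurable M" for k
    unfolding G_def by measurable
  define B' where "B' = 2 * B + 2 * (LINT x|M. (norm (f x))\<^sup>2)"
  have G2: "integrable M (\<lambda>x. (G k x)\<^sup>2)" for k
    using integrable_norm_add_square[of "F k" M "\<lambda>x. - f x"] F2 f2 by (simp add: G_def)
  have G2_le: "(LINT x|M. (G k x)\<^sup>2) \<le> B'" for k
    using LINT_norm_add_square_le[of "F k" M "\<lambda>x. - f x"] F2 f2 bound[of k] by (simp add: G_def B'_def)
  have "B' \<ge> 0"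
    by (rule order_trans[OF _ G2_le[of 0]]) simp
  have Fint: "integrable M (F k)" for k
    using F2 by (intro integrable_of_square_integrable) auto
  have fint: "integrable M f"
    using f2 by (intro integrable_of_square_integrable) auto
  have Gint: "integrable M (G k)" for k
    unfolding G_def using Fint fint by simp
  have min_int: "integrable M (\<lambda>x. min (G k x) K)" if "K > 0" for k K
    by (rule integrable_const_bound[of _ K]) (use that in \<open>auto simp: G_def\<close>)
  have min_lim: "(\<lambda>k. LINT x|M. min (G k x) K) \<longlonglongrightarrow> (LINT x|M. 0)" if "K > 0" for K
  proof (rule integral_dominated_convergence[where w = "\<lambda>_. K"])
    show "AE x in M. (\<lambda>k. min (G k x) K) \<longlonglongrightarrow> 0"
      using lim
    proof eventually_elim
      case (elim x)
      then have "(\<lambda>k. G k x) \<longlonglongrightarrow> 0"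
        unfolding G_def by (simp add: LIM_zero_iff tendsto_norm_zero)
      then have "(\<lambda>k. min (G k x) K) \<longlonglongrightarrow> min 0 K"
        by (intro tendsto_min tendsto_const)
      with that show ?case by simp
    qed
  qed (use that in \<open>auto simp: G_def\<close>)
  have "(\<lambda>k. LINT x|M. G k x) \<longlonglongrightarrow> 0"
  proof (rule order_tendstoI)
    fix e :: real assume "0 < e"
    define K where "K = 2 * (B' + 1) / e"
    have "K > 0" "B' / K < e / 2"
      using \<open>0 < e\<close> \<open>B' \<ge> 0\<close> by (auto simp: K_def field_simps)
    have "eventually (\<lambda>k. (LINT x|M. min (G k x) K) < e / 2) sequentially"
      using min_lim[OF \<open>K > 0\<close>] \<open>0 < e\<close> by (intro order_tendstoD) auto
    then show "eventually (\<lambda>k. (LINT x|M. G k x) < e) sequentially"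
    proof eventually_elim
      case (elim k)
      have pw: "G k x \<le> min (G k x) K + (G k x)\<^sup>2 / K" for x
      proof (cases "G k x \<le> K")
        case False
        then have "G k x * K \<le> (G k x)\<^sup>2" using \<open>K > 0\<close> by (simp add: power2_eq_square)
        then have "G k x \<le> (G k x)\<^sup>2 / K" using \<open>K > 0\<close> by (simp add: pos_le_divide_eq)
        with False \<open>K > 0\<close> show ?thesis by simp
      qed (use \<open>K > 0\<close> in auto)
      have "(LINT x|M. G k x) \<le> (LINT x|M. min (G k x) K + (G k x)\<^sup>2 / K)"
        using min_int[OF \<open>K > 0\<close>] G2 Gint by (intro integral_mono pw) auto
      also have "\<dots> = (LINT x|M. min (G k x) K) + (LINT x|M. (G k x)\<^sup>2) / K"
        using min_int[OF \<open>K > 0\<close>] G2 by simp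
      also have "\<dots> < e / 2 + B' / K"
        using elim G2_le[of k] \<open>K > 0\<close> by (intro add_less_le_mono divide_right_mono) auto
      also have "\<dots> < e"
        using \<open>B' / K < e / 2\<close> by linarith
      finally show ?case .
    qed
  next
    fix e :: real assume "e < 0"
    moreover have "(LINT x|M. G k x) \<ge> 0" for k
      by (rule integral_nonneg_AE) (simp add: G_def)
    ultimately show "eventually (\<lambda>k. e < (LINT x|M. G k x)) sequentially"
      by (intro always_eventually allI) (smt (verit))
  qed
  then have "(\<lambda>k. (LINT x|M. F k x) - (LINT x|M. f x)) \<longlonglongrightarrow> 0"
  proof (rule Lim_null_comparison[rotated])
    show "eventually (\<lambda>k. norm ((LINT x|M. F k x) - (LINT x|M. f x)) \<le> (LINT x|M. G k x)) sequentially"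
      using integral_norm_bound[of M "\<lambda>x. F k x - f x" for k] Fint fint
      by (simp add: G_def)
  qed
  then show ?thesis
    by (simp add: LIM_zero_iff)
qed

section \<open>The circle\<close>

lemma space_circle_measure [simp]: "space circle_measure = sphere 0 1"
  by (simp add: circle_measure_def)

lemma sets_circle_measure [measurable_cong]:
  "sets circle_measure = sets (restrict_space borel (sphere 0 1))"
  by (simp add: circle_measure_def)

lemma cis_measurable_circle [measurable]:
  "cis \<in> borel \<rightarrow>\<^sub>M restrict_space borel (sphere 0 1)"
  by (intro measurable_restrict_space2 borel_measurable_continuous_onI continuous_intros) auto

lemma finite_measure_circle: "finite_measure circle_measure"
proof -
  interpret finite_measure "uniform_measure lborel {0..2 * pi}"
    by (intro finite_measureI) (simp add: emeasure_uniform_measure)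
  show ?thesis
    unfolding circle_measure_def by (rule finite_measure_distr) measurable
qed

interpretation circle: finite_measure circle_measure
  by (rule finite_measure_circle)

lemma continuous_on_sphere_measurable:
  "continuous_on (sphere 0 1) f \<Longrightarrow> f \<in> borel_measurable circle_measure"
  using borel_measurable_continuous_on_restrict[of "sphere 0 1" f]
  by (simp add: measurable_cong_sets[OF sets_circle_measure refl])

text \<open>
  This links the circle measure to the gauge integral over an interval, in whose terms contour
  integrals along circles are expressed.
\<close>
lemma has_integral_cis_circle_measure:
  fixes f :: "complex \<Rightarrow> complex"
  assumes "continuous_on (sphere 0 1) f"
  shows "((\<lambda>t. f (cis t)) has_integral (2 * pi * (LINT z|circle_measure. f z))) {0..2 * pi}"
proof -
  have [measurable]: "f \<in> borel_measurable circle_measure"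
    using assms by (rule continuous_on_sphere_measurable)
  then have [measurable]: "f \<in> borel_measurable (restrict_space borel (sphere 0 1))"
    by (simp add: measurable_cong_sets[OF sets_circle_measure refl])
  have um: "uniform_measure lborel {0..2 * pi} =
      density lborel (\<lambda>x. ennreal (indicator {0..2 * pi} x / (2 * pi)))"
    unfolding uniform_measure_def
    by (intro density_cong) (auto simp: indicator_def divide_ennreal simp flip: ennreal_1)
  have cont: "continuous_on {0..2 * pi} (\<lambda>t. f (cis t))"
    by (rule continuous_on_compose2[OF assms]) (auto intro!: continuous_intros)
  have "(LINT z|circle_measure. f z) = (LINT t|uniform_measure lborel {0..2 * pi}. f (cis t))"
    unfolding circle_measure_def by (subst integral_distr) auto
  also have "\<dots> = (LINT t|lborel. (indicator {0..2 * pi} t / (2 * pi)) *\<^sub>R f (cis t))"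
    unfolding um by (subst integral_density) auto
  also have "\<dots> = (LINT t:{0..2 * pi}|lborel. f (cis t)) / (2 * pi)"
    by (simp add: set_lebesgue_integral_def scaleR_conv_of_real flip: integral_divide_zero)
  also have "(LINT t:{0..2 * pi}|lborel. f (cis t)) = integral {0..2 * pi} (\<lambda>t. f (cis t))"
    by (intro set_borel_integral_eq_integral borel_integrable_atLeastAtMost' cont)
  finally have "2 * pi * (LINT z|circle_measure. f z) = integral {0..2 * pi} (\<lambda>t. f (cis t))"
    by simp
  moreover have "(\<lambda>t. f (cis t)) integrable_on {0..2 * pi}"
    using cont by (intro integrable_continuous_interval)
  ultimately show ?thesis
    by (metis integrable_integral)
qed

lemma L2_circleD:
  assumes "f \<in> L2_circle"
  shows "f \<in> borel_measurable circle_measure" "integrable circle_measure (\<lambda>z. (norm (f z))\<^sup>2)"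
  using assms by (auto simp: L2_circle_def)

lemma L2_circle_add:
  "f \<in> L2_circle \<Longrightarrow> g \<in> L2_circle \<Longrightarrow> (\<lambda>z. f z + g z) \<in> L2_circle"
  by (auto simp: L2_circle_def intro!: integrable_norm_add_square)

lemma L2_circle_cnj: "f \<in> L2_circle \<Longrightarrow> (\<lambda>z. cnj (f z)) \<in> L2_circle"
  using borel_measurable_continuous_onI[OF continuous_on_cnj[OF continuous_on_id]]
  by (auto simp: L2_circle_def intro: measurable_compose)

lemma L2_circle_mult:
  assumes "b \<in> Linf_circle" "f \<in> L2_circle"
  shows "(\<lambda>z. b z * f z) \<in> L2_circle"
proof -
  have [measurable]: "b \<in> borel_measurable circle_measure" "f \<in> borel_measurable circle_measure"
    using assms by (auto simp: L2_circle_def Linf_circle_def)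
  obtain B where B: "AE z in circle_measure. norm (b z) \<le> B"
    using assms by (auto simp: Linf_circle_def)
  have "integrable circle_measure (\<lambda>z. (norm (b z * f z))\<^sup>2)"
  proof (rule Bochner_Integration.integrable_bound)
    show "integrable circle_measure (\<lambda>z. B\<^sup>2 * (norm (f z))\<^sup>2)"
      using L2_circleD[OF assms(2)] by simp
    show "AE z in circle_measure. norm ((norm (b z * f z))\<^sup>2) \<le> norm (B\<^sup>2 * (norm (f z))\<^sup>2)"
      using B by eventually_elim (auto simp: norm_mult power_mult_distrib intro!: mult_right_mono power_mono)
  qed measurable
  then show ?thesis by (simp add: L2_circle_def)
qed

lemma Linf_circle_subset_L2_circle: "f \<in> Linf_circle \<Longrightarrow> f \<in> L2_circle"
  using L2_circle_mult[of f "\<lambda>_. 1"] by (simp add: L2_circle_def)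

lemma continuous_on_sphere_Linf_circle:
  assumes "continuous_on (sphere 0 1) f"
  shows "f \<in> Linf_circle"
proof -
  have "bounded (f ` sphere 0 1)"
    by (intro compact_imp_bounded compact_continuous_image assms compact_sphere)
  then obtain B where "\<forall>z\<in>sphere 0 1. norm (f z) \<le> B"
    by (auto simp: bounded_iff)
  then have "AE z in circle_measure. norm (f z) \<le> B"
    by (intro AE_I2) auto
  then show ?thesis
    using continuous_on_sphere_measurable[OF assms] by (auto simp: Linf_circle_def)
qed

lemma L2_circle_cmult: "f \<in> L2_circle \<Longrightarrow> (\<lambda>z. c * f z) \<in> L2_circle"
  by (intro L2_circle_mult continuous_on_sphere_Linf_circle continuous_intros)

lemma L2_circle_integrable_mult:
  "f \<in> L2_circle \<Longrightarrow> g \<in> L2_circle \<Longrightarrow> integrable circle_measure (\<lambda>z. f z * g z)"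
  by (auto simp: L2_circle_def intro!: integrable_mult_of_square_integrable)

lemma L2_circle_integrable_inner:
  "f \<in> L2_circle \<Longrightarrow> g \<in> L2_circle \<Longrightarrow> integrable circle_measure (\<lambda>z. f z * cnj (g z))"
  by (intro L2_circle_integrable_mult L2_circle_cnj)

section \<open>The Hardy space\<close>

text \<open>
  These functions serve as multipliers of the Hardy space: continuity up to the circle gives both a
  bound and the radial limit at every boundary point.
\<close>
definition disc_algebra :: "(complex \<Rightarrow> complex) set" where
  "disc_algebra = {f. continuous_on (cball 0 1) f \<and> f holomorphic_on ball 0 1}"

lemma disc_algebra_Linf_circle: "f \<in> disc_algebra \<Longrightarrow> f \<in> Linf_circle"
  by (intro continuous_on_sphere_Linf_circle) (auto simp: disc_algebra_def intro: continuous_on_subset)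

lemma disc_algebra_mult:
  "f \<in> disc_algebra \<Longrightarrow> g \<in> disc_algebra \<Longrightarrow> (\<lambda>z. f z * g z) \<in> disc_algebra"
  by (auto simp: disc_algebra_def intro!: continuous_intros holomorphic_intros)

lemma disc_algebra_const: "(\<lambda>_. c) \<in> disc_algebra"
  by (auto simp: disc_algebra_def)

lemma continuous_on_dilation:
  fixes r :: real
  assumes "f holomorphic_on ball 0 1" "0 \<le> r" "r < 1"
  shows "continuous_on (sphere 0 1) (\<lambda>z. f (of_real r * z))"
  by (rule continuous_on_compose2[OF holomorphic_on_imp_continuous_on[OF assms(1)]])
     (use assms in \<open>auto intro!: continuous_intros simp: norm_mult\<close>)

lemma integrable_norm_square_dilation:
  fixes r :: real
  assumes "f holomorphic_on ball 0 1" "0 \<le> r" "r < 1"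
  shows "integrable circle_measure (\<lambda>z. (norm (f (of_real r * z)))\<^sup>2)"
  using Linf_circle_subset_L2_circle[OF continuous_on_sphere_Linf_circle[OF continuous_on_dilation[OF assms]]]
  by (simp add: L2_circle_def)

lemma hardy2D:
  assumes "f \<in> hardy2"
  shows "f \<in> L2_circle" "f holomorphic_on ball 0 1"
    "AE z in circle_measure. ((\<lambda>r::real. f (of_real r * z)) \<longlongrightarrow> f z) (at_left 1)"
  using assms by (auto simp: hardy2_def)

lemma hardy2_add:
  assumes "f \<in> hardy2" "g \<in> hardy2"
  shows "(\<lambda>z. f z + g z) \<in> hardy2"
proof -
  obtain B C where B: "\<And>r. 0 \<le> r \<Longrightarrow> r < 1 \<Longrightarrow> (LINT z|circle_measure. (norm (f (of_real r * z)))\<^sup>2) \<le> B"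
    and C: "\<And>r. 0 \<le> r \<Longrightarrow> r < 1 \<Longrightarrow> (LINT z|circle_measure. (norm (g (of_real r * z)))\<^sup>2) \<le> C"
    using assms by (fastforce simp: hardy2_def)
  note hol = hardy2D(2)[OF assms(1)] hardy2D(2)[OF assms(2)]
  have "(LINT z|circle_measure. (norm (f (of_real r * z) + g (of_real r * z)))\<^sup>2) \<le> 2 * B + 2 * C"
    if r: "0 \<le> r" "r < 1" for r
  proof -
    have "(LINT z|circle_measure. (norm (f (of_real r * z) + g (of_real r * z)))\<^sup>2)
        \<le> 2 * (LINT z|circle_measure. (norm (f (of_real r * z)))\<^sup>2)
          + 2 * (LINT z|circle_measure. (norm (g (of_real r * z)))\<^sup>2)"
      using r hol by (intro LINT_norm_add_square_le integrable_norm_square_dilation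
          continuous_on_sphere_measurable continuous_on_dilation) auto
    with B[OF r] C[OF r] show ?thesis by linarith
  qed
  moreover have "AE z in circle_measure.
      ((\<lambda>r::real. f (of_real r * z) + g (of_real r * z)) \<longlongrightarrow> f z + g z) (at_left 1)"
    using hardy2D(3)[OF assms(1)] hardy2D(3)[OF assms(2)]
    by eventually_elim (rule tendsto_add)
  ultimately show ?thesis
    using hol assms[THEN hardy2D(1)]
    by (auto simp: hardy2_def intro!: L2_circle_add holomorphic_intros exI[of _ "2 * B + 2 * C"])
qed

lemma disc_algebra_mult_hardy2:
  assumes f: "f \<in> disc_algebra" and g: "g \<in> hardy2"
  shows "(\<lambda>z. f z * g z) \<in> hardy2"
proof -
  have contf: "continuous_on (cball 0 1) f" and holf: "f holomorphic_on ball 0 1"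
    using f by (auto simp: disc_algebra_def)
  note holg = hardy2D(2)[OF g]
  obtain B where B: "\<And>r. 0 \<le> r \<Longrightarrow> r < 1 \<Longrightarrow> (LINT z|circle_measure. (norm (g (of_real r * z)))\<^sup>2) \<le> B"
    using g by (fastforce simp: hardy2_def)
  have "bounded (f ` cball 0 1)"
    by (intro compact_imp_bounded compact_continuous_image contf compact_cball)
  then obtain K where "\<forall>z\<in>cball 0 1. norm (f z) \<le> K"
    by (auto simp: bounded_iff)
  then have K: "norm (f z) \<le> K" if "norm z \<le> 1" for z
    using that by simp
  have "(LINT z|circle_measure. (norm (f (of_real r * z) * g (of_real r * z)))\<^sup>2) \<le> K\<^sup>2 * B"
    if r: "0 \<le> r" "r < 1" for r
  proof -
    have "(LINT z|circle_measure. (norm (f (of_real r * z) * g (of_real r * z)))\<^sup>2)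
        \<le> (LINT z|circle_measure. K\<^sup>2 * (norm (g (of_real r * z)))\<^sup>2)"
    proof (rule integral_mono)
      show "integrable circle_measure (\<lambda>z. (norm (f (of_real r * z) * g (of_real r * z)))\<^sup>2)"
        by (rule integrable_norm_square_dilation[OF holomorphic_on_mult[OF holf holg] r])
      show "integrable circle_measure (\<lambda>z. K\<^sup>2 * (norm (g (of_real r * z)))\<^sup>2)"
        using integrable_norm_square_dilation[OF holg r] by simp
      fix z assume "z \<in> space circle_measure"
      then have "norm (f (of_real r * z)) \<le> K"
        using r by (intro K) (auto simp: norm_mult)
      then show "(norm (f (of_real r * z) * g (of_real r * z)))\<^sup>2 \<le> K\<^sup>2 * (norm (g (of_real r * z)))\<^sup>2"
        by (auto simp: norm_mult power_mult_distrib intro!: mult_right_mono power_mono)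
    qed
    also have "\<dots> = K\<^sup>2 * (LINT z|circle_measure. (norm (g (of_real r * z)))\<^sup>2)"
      by simp
    also have "\<dots> \<le> K\<^sup>2 * B"
      using B[OF r] by (intro mult_left_mono) auto
    finally show ?thesis .
  qed
  moreover have "AE z in circle_measure.
      ((\<lambda>r::real. f (of_real r * z) * g (of_real r * z)) \<longlongrightarrow> f z * g z) (at_left 1)"
    using hardy2D(3)[OF g] AE_space
  proof eventually_elim
    case (elim z)
    have "((\<lambda>r::real. of_real r * z) \<longlongrightarrow> of_real 1 * z) (at_left 1)"
      by (intro tendsto_intros)
    moreover have "\<forall>\<^sub>F r in at_left (1::real). of_real r * z \<in> cball 0 1"
    proof -
      have "\<forall>\<^sub>F r in at_left (1::real). r \<in> {0<..<1}"
        by (rule eventually_at_left_real) simp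
      then show ?thesis
        by eventually_elim (use elim in \<open>auto simp: norm_mult\<close>)
    qed
    ultimately have "((\<lambda>r::real. f (of_real r * z)) \<longlongrightarrow> f (of_real 1 * z)) (at_left 1)"
      by (intro continuous_on_tendsto_compose[OF contf]) (use elim in auto)
    with elim(1) show ?case by (intro tendsto_mult) auto
  qed
  ultimately show ?thesis
    using holf holg hardy2D(1)[OF g] disc_algebra_Linf_circle[OF f]
    by (auto simp: hardy2_def intro!: L2_circle_mult holomorphic_intros exI[of _ "K\<^sup>2 * B"])
qed

lemma disc_algebra_subset_hardy2:
  assumes "f \<in> disc_algebra"
  shows "f \<in> hardy2"
proof -
  have "(\<lambda>_. 1) \<in> hardy2"
    using Linf_circle_subset_L2_circle[OF disc_algebra_Linf_circle[OF disc_algebra_const[of 1]]]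
    by (auto simp: hardy2_def)
  from disc_algebra_mult_hardy2[OF assms this] show ?thesis by simp
qed

lemma hardy2_cmult: "f \<in> hardy2 \<Longrightarrow> (\<lambda>z. c * f z) \<in> hardy2"
  by (intro disc_algebra_mult_hardy2 disc_algebra_const)

lemma hardy2_sum:
  "(\<And>i. i \<in> I \<Longrightarrow> f i \<in> hardy2) \<Longrightarrow> (\<lambda>z. \<Sum>i\<in>I. f i z) \<in> hardy2"
proof (induction I rule: infinite_finite_induct)
  case (insert i I)
  then show ?case using hardy2_add[of "f i" "\<lambda>z. \<Sum>i\<in>I. f i z"] by simp
qed (use disc_algebra_subset_hardy2[OF disc_algebra_const[of 0]] in auto)

text \<open>
  The Cauchy formula on the circle of radius \<open>r < 1\<close>, in the limit \<open>r \<longlonglongrightarrow> 1\<close>.  The bounded square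
  means in the definition of the Hardy space are what allows passing to the limit under the integral.
\<close>
lemma hardy2_Cauchy_formula:
  assumes f: "f \<in> hardy2" and w: "norm w < 1"
  shows "(LINT z|circle_measure. f z * (z / (z - w))) = f w"
proof -
  note holf = hardy2D(2)[OF f]
  obtain B where B: "\<And>r. 0 \<le> r \<Longrightarrow> r < 1 \<Longrightarrow> (LINT z|circle_measure. (norm (f (of_real r * z)))\<^sup>2) \<le> B"
    using f by (fastforce simp: hardy2_def)
  define d where "d = 1 - norm w"
  have "0 < d" "d \<le> 1" using w by (auto simp: d_def)
  \<comment> \<open>The radii tend to 1 and keep the distance \<open>d / 2\<close> from \<open>w\<close>, so that the Cauchy kernels stay bounded.\<close>
  define r where "r = (\<lambda>k. 1 - d / 2 / real (Suc k))"
  have r: "0 \<le> r k" "r k < 1" "d / 2 \<le> r k - norm w" for k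
  proof -
    have "d / 2 / real (Suc k) \<le> d / 2"
      using \<open>0 < d\<close> by (simp add: field_simps)
    moreover have "d / 2 / real (Suc k) > 0"
      using \<open>0 < d\<close> by simp
    moreover have "norm w = 1 - d"
      by (simp add: d_def)
    ultimately show "0 \<le> r k" "r k < 1" "d / 2 \<le> r k - norm w"
      using \<open>d \<le> 1\<close> unfolding r_def by linarith+
  qed
  have "r \<longlonglongrightarrow> 1 - 0"
    unfolding r_def by (intro tendsto_diff tendsto_const LIMSEQ_Suc[OF lim_const_over_n, of "d / 2"])
  then have r_left: "filterlim r (at_left 1) sequentially"
    using r(2) by (auto simp: filterlim_at less_imp_neq)
  have ne: "of_real (r k) * z - w \<noteq> 0" "d / 2 \<le> norm (of_real (r k) * z - w)"
    if "norm z = 1" for z k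
  proof -
    have "r k - norm w \<le> norm (of_real (r k) * z - w)"
      using norm_triangle_ineq2[of "of_real (r k) * z" w] that r[of k] by (simp add: norm_mult)
    then show "d / 2 \<le> norm (of_real (r k) * z - w)"
      using r(3)[of k] by linarith
    then show "of_real (r k) * z - w \<noteq> 0"
      using \<open>0 < d\<close> by auto
  qed
  define F where "F = (\<lambda>k z. f (of_real (r k) * z) * (of_real (r k) * z / (of_real (r k) * z - w)))"
  have contF: "continuous_on (sphere 0 1) (F k)" for k
    unfolding F_def using ne(1)[of _ k]
    by (intro continuous_intros continuous_on_dilation holf r) auto
  have F_LINT: "(LINT z|circle_measure. F k z) = f w" for k
  proof -
    have "0 < r k" "norm w < r k"
      using r(3)[of k] \<open>0 < d\<close> norm_ge_zero[of w] by linarith+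
    have "f holomorphic_on cball 0 (r k)"
      using r(2)[of k] by (intro holomorphic_on_subset[OF holf]) auto
    then have "((\<lambda>u. f u / (u - w)) has_contour_integral (2 * of_real pi * \<i> * f w)) (circlepath 0 (r k))"
      using \<open>norm w < r k\<close> by (intro Cauchy_integral_circlepath_simple) auto
    then have "((\<lambda>t. f (of_real (r k) * cis t) / (of_real (r k) * cis t - w) * of_real (r k) * \<i> * cis t)
        has_integral (2 * of_real pi * \<i> * f w)) {0..2 * pi}"
      unfolding circlepath_def by (subst (asm) has_contour_integral_part_circlepath_iff) auto
    moreover have "(\<lambda>t. f (of_real (r k) * cis t) / (of_real (r k) * cis t - w) * of_real (r k) * \<i> * cis t)
        = (\<lambda>t. \<i> * F k (cis t))"
      by (auto simp: F_def fun_eq_iff)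
    ultimately have "((\<lambda>t. \<i> * F k (cis t)) has_integral (2 * of_real pi * \<i> * f w)) {0..2 * pi}"
      by simp
    moreover have "((\<lambda>t. \<i> * F k (cis t)) has_integral (\<i> * (2 * pi * (LINT z|circle_measure. F k z)))) {0..2 * pi}"
      by (intro has_integral_mult_right has_integral_cis_circle_measure contF)
    ultimately have "2 * of_real pi * \<i> * f w = \<i> * (2 * pi * (LINT z|circle_measure. F k z))"
      by (rule has_integral_unique)
    then show ?thesis by simp
  qed
  have kernel: "(\<lambda>z. z / (z - w)) \<in> Linf_circle"
    using w by (intro continuous_on_sphere_Linf_circle continuous_intros) auto
  have "(\<lambda>k. LINT z|circle_measure. F k z) \<longlonglongrightarrow> (LINT z|circle_measure. f z * (z / (z - w)))"
  proof (rule circle.LINT_tendsto_of_square_means_bounded[where B = "(2 / d)\<^sup>2 * B"])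
    show "F k \<in> borel_measurable circle_measure" for k
      by (intro continuous_on_sphere_measurable contF)
    show F2: "integrable circle_measure (\<lambda>z. (norm (F k z))\<^sup>2)" for k
      by (intro L2_circleD Linf_circle_subset_L2_circle continuous_on_sphere_Linf_circle contF)
    show "(LINT z|circle_measure. (norm (F k z))\<^sup>2) \<le> (2 / d)\<^sup>2 * B" for k
    proof -
      have "(LINT z|circle_measure. (norm (F k z))\<^sup>2)
          \<le> (LINT z|circle_measure. (2 / d)\<^sup>2 * (norm (f (of_real (r k) * z)))\<^sup>2)"
      proof (rule integral_mono[OF F2])
        show "integrable circle_measure (\<lambda>z. (2 / d)\<^sup>2 * (norm (f (of_real (r k) * z)))\<^sup>2)"
          using integrable_norm_square_dilation[OF holf r(1,2)] by simp
        fix z assume "z \<in> space circle_measure"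
        then have z: "norm z = 1" by simp
        have "norm (of_real (r k) * z / (of_real (r k) * z - w)) \<le> 1 / (d / 2)"
          unfolding norm_divide using ne(2)[OF z, of k] r[of k] \<open>0 < d\<close> z
          by (intro frac_le) (auto simp: norm_mult)
        then have "norm (F k z) \<le> norm (f (of_real (r k) * z)) * (2 / d)"
          unfolding F_def norm_mult[of "f _"] by (intro mult_left_mono) auto
        then have "(norm (F k z))\<^sup>2 \<le> (norm (f (of_real (r k) * z)) * (2 / d))\<^sup>2"
          by (intro power_mono) auto
        then show "(norm (F k z))\<^sup>2 \<le> (2 / d)\<^sup>2 * (norm (f (of_real (r k) * z)))\<^sup>2"
          unfolding power_mult_distrib by (simp only: mult.commute)
      qed
      also have "\<dots> = (2 / d)\<^sup>2 * (LINT z|circle_measure. (norm (f (of_real (r k) * z)))\<^sup>2)"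
        by simp
      also have "\<dots> \<le> (2 / d)\<^sup>2 * B"
        by (intro mult_left_mono B r) auto
      finally show ?thesis .
    qed
    have fk: "(\<lambda>z. f z * (z / (z - w))) \<in> L2_circle"
      using L2_circle_mult[OF kernel hardy2D(1)[OF f]] by (simp add: mult.commute)
    show "(\<lambda>z. f z * (z / (z - w))) \<in> borel_measurable circle_measure"
      "integrable circle_measure (\<lambda>z. (norm (f z * (z / (z - w))))\<^sup>2)"
      by (fact L2_circleD[OF fk])+
    show "AE z in circle_measure. (\<lambda>k. F k z) \<longlonglongrightarrow> f z * (z / (z - w))"
      using hardy2D(3)[OF f] AE_space
    proof eventually_elim
      case (elim z)
      have "z - w \<noteq> 0" using elim w by auto
      have "(\<lambda>k. of_real (r k) * z) \<longlonglongrightarrow> of_real 1 * z"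
        using \<open>r \<longlonglongrightarrow> 1 - 0\<close> by (intro tendsto_intros) auto
      then have "(\<lambda>k. of_real (r k) * z / (of_real (r k) * z - w)) \<longlonglongrightarrow> z / (z - w)"
        using \<open>z - w \<noteq> 0\<close> by (intro tendsto_intros) auto
      moreover have "(\<lambda>k. f (of_real (r k) * z)) \<longlonglongrightarrow> f z"
        using filterlim_compose[OF elim(1) r_left] .
      ultimately show ?case
        unfolding F_def by (intro tendsto_mult)
    qed
  qed
  then show ?thesis
    by (simp add: F_LINT LIMSEQ_const_iff)
qed

text \<open>
  Both sides are the same Cauchy integral over the boundary values.
\<close>
lemma hardy2_eq_on_disc:
  assumes "f \<in> hardy2" "g \<in> hardy2" "AE z in circle_measure. f z = g z" "norm w < 1"
  shows "f w = g w"
proof -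
  have kernel: "(\<lambda>z. z / (z - w)) \<in> L2_circle"
    using assms(4)
    by (intro Linf_circle_subset_L2_circle continuous_on_sphere_Linf_circle continuous_intros) auto
  have "(LINT z|circle_measure. f z * (z / (z - w))) = (LINT z|circle_measure. g z * (z / (z - w)))"
  proof (rule integral_cong_AE)
    show "AE z in circle_measure. f z * (z / (z - w)) = g z * (z / (z - w))"
      using assms(3) by eventually_elim simp
  qed (intro borel_measurable_integrable L2_circle_integrable_mult kernel hardy2D(1) assms)+
  then show ?thesis
    using hardy2_Cauchy_formula[OF assms(1,4)] hardy2_Cauchy_formula[OF assms(2,4)] by simp
qed

section \<open>Inner products\<close>

lemma L2_inner_cong_AE:
  assumes "f \<in> L2_circle" "f' \<in> L2_circle" "g \<in> L2_circle" "g' \<in> L2_circle"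
    and "AE z in circle_measure. f z = f' z" "AE z in circle_measure. g z = g' z"
  shows "L2_inner f g = L2_inner f' g'"
  unfolding L2_inner_def
proof (rule integral_cong_AE)
  show "AE z in circle_measure. f z * cnj (g z) = f' z * cnj (g' z)"
    using assms(5,6) by eventually_elim simp
qed (intro borel_measurable_integrable L2_circle_integrable_inner assms)+

lemma L2_inner_commute: "L2_inner f g = cnj (L2_inner g f)"
  unfolding L2_inner_def by (subst Bochner_Integration.integral_cnj[symmetric]) (simp add: mult.commute)

lemma L2_inner_diff_left:
  assumes "f \<in> L2_circle" "g \<in> L2_circle" "h \<in> L2_circle"
  shows "L2_inner (\<lambda>z. f z - g z) h = L2_inner f h - L2_inner g h"
  using assms by (simp add: L2_inner_def left_diff_distrib L2_circle_integrable_inner)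

lemma L2_circle_sum:
  "(\<And>j. j \<in> J \<Longrightarrow> f j \<in> L2_circle) \<Longrightarrow> (\<lambda>z. \<Sum>j\<in>J. f j z) \<in> L2_circle"
proof (induction J rule: infinite_finite_induct)
  case (insert j J)
  then show ?case using L2_circle_add[of "f j" "\<lambda>z. \<Sum>j\<in>J. f j z"] by simp
qed (auto simp: L2_circle_def)

lemma L2_inner_sum_left:
  assumes "\<And>j. j \<in> J \<Longrightarrow> f j \<in> L2_circle" "g \<in> L2_circle"
  shows "L2_inner (\<lambda>z. \<Sum>j\<in>J. c j * f j z) g = (\<Sum>j\<in>J. c j * L2_inner (f j) g)"
proof -
  have int: "integrable circle_measure (\<lambda>z. c j * (f j z * cnj (g z)))" if "j \<in> J" for j
    using L2_circle_integrable_inner[OF assms(1)[OF that] assms(2)] by simp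
  have "L2_inner (\<lambda>z. \<Sum>j\<in>J. c j * f j z) g = (LINT z|circle_measure. (\<Sum>j\<in>J. c j * (f j z * cnj (g z))))"
    by (simp add: L2_inner_def sum_distrib_right mult.assoc)
  also have "\<dots> = (\<Sum>j\<in>J. LINT z|circle_measure. c j * (f j z * cnj (g z)))"
    by (rule Bochner_Integration.integral_sum[OF int])
  finally show ?thesis by (simp add: L2_inner_def)
qed

lemma L2_inner_sum_right:
  assumes "\<And>j. j \<in> J \<Longrightarrow> f j \<in> L2_circle" "g \<in> L2_circle"
  shows "L2_inner g (\<lambda>z. \<Sum>j\<in>J. c j * f j z) = (\<Sum>j\<in>J. cnj (c j) * L2_inner g (f j))"
proof -
  have "L2_inner g (\<lambda>z. \<Sum>j\<in>J. c j * f j z) = cnj (\<Sum>j\<in>J. c j * L2_inner (f j) g)"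
    by (subst L2_inner_commute) (simp add: L2_inner_sum_left assms)
  also have "\<dots> = (\<Sum>j\<in>J. cnj (c j) * L2_inner g (f j))"
    by (simp add: cnj_sum) (intro sum.cong refl, subst L2_inner_commute, simp)
  finally show ?thesis .
qed

section \<open>The model space of a finite Blaschke product\<close>

locale finite_blaschke =
  fixes n :: nat and \<theta> :: "complex \<Rightarrow> complex" and c :: complex and a :: "nat \<Rightarrow> complex"
  assumes norm_c: "norm c = 1"
    and zeros: "k < n \<Longrightarrow> norm (a k) < 1"
    and \<theta>_eq: "norm z \<le> 1 \<Longrightarrow> \<theta> z = c * (\<Prod>k<n. (z - a k) / (1 - cnj (a k) * z))"
begin

definition denom :: "complex \<Rightarrow> complex" where
  "denom z = (\<Prod>k<n. 1 - cnj (a k) * z)"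

lemma denom_nonzero:
  assumes "norm z \<le> 1"
  shows "denom z \<noteq> 0"
proof -
  have "1 - cnj (a k) * z \<noteq> 0" if "k < n" for k
  proof
    assume "1 - cnj (a k) * z = 0"
    then have "norm (a k) * norm z = 1"
      by (metis complex_mod_cnj eq_iff_diff_eq_0 norm_mult norm_one)
    moreover have "norm (a k) * norm z \<le> norm (a k) * 1"
      using assms by (intro mult_left_mono) auto
    ultimately show False using zeros[OF that] by simp
  qed
  then show ?thesis by (simp add: denom_def)
qed

lemma poly_div_denom_disc_algebra: "(\<lambda>z. poly p z / denom z) \<in> disc_algebra"
proof -
  have "continuous_on (cball 0 1) (\<lambda>z. poly p z / denom z)"
    using denom_nonzero by (auto intro!: continuous_intros simp: denom_def)
  moreover have "(\<lambda>z. poly p z / denom z) holomorphic_on ball 0 1"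
    using denom_nonzero by (auto intro!: holomorphic_intros simp: denom_def)
  ultimately show ?thesis by (simp add: disc_algebra_def)
qed

lemma \<theta>_eq_div_denom: "norm z \<le> 1 \<Longrightarrow> \<theta> z = c * (\<Prod>k<n. z - a k) / denom z"
  by (simp add: \<theta>_eq denom_def prod_dividef)

lemma continuous_on_\<theta>: "continuous_on (sphere 0 1) \<theta>"
proof -
  have "continuous_on (sphere 0 1) (\<lambda>z. c * (\<Prod>k<n. z - a k) / denom z)"
    using denom_nonzero by (auto intro!: continuous_intros simp: denom_def)
  then show ?thesis
    by (rule continuous_on_cong[THEN iffD1, rotated 2]) (auto simp: \<theta>_eq_div_denom)
qed

lemma \<theta>_Linf_circle: "\<theta> \<in> Linf_circle"
  by (rule continuous_on_sphere_Linf_circle[OF continuous_on_\<theta>])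

lemma \<theta>_unimodular:
  assumes "norm z = 1"
  shows "\<theta> z * cnj (\<theta> z) = 1"
proof -
  have "norm ((z - a k) / (1 - cnj (a k) * z)) = 1" if "k < n" for k
  proof -
    have "cnj z * (z - a k) = cnj (1 - cnj (a k) * z)"
      using assms by (simp add: algebra_simps complex_norm_square flip: complex_norm_square)
    then have "norm (cnj z * (z - a k)) = norm (1 - cnj (a k) * z)"
      by (metis complex_mod_cnj)
    then have "norm (1 - cnj (a k) * z) = norm (z - a k)"
      using assms by (simp add: norm_mult)
    moreover have "z \<noteq> a k" using zeros[OF that] assms by auto
    ultimately show ?thesis by (simp only: norm_divide) simp
  qed
  then have "norm (\<theta> z) = 1"
    using assms norm_c by (simp add: \<theta>_eq norm_mult prod_norm[symmetric])
  then show ?thesis by (simp add: complex_norm_square[symmetric])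
qed

definition basic :: "nat \<Rightarrow> complex \<Rightarrow> complex" where
  "basic k z = z ^ k / denom z"

lemma basic_disc_algebra: "basic k \<in> disc_algebra"
  using poly_div_denom_disc_algebra[of "Polynomial.monom 1 k"] by (simp add: basic_def[abs_def] poly_monom)

text \<open>
  On the circle \<open>cnj z = 1 / z\<close>, so \<open>z\<^sup>n * cnj (denom z)\<close> is the numerator of \<open>\<theta>\<close>.  Divided
  by \<open>z\<close>, the identity says that the canonical conjugation \<open>\<theta> * cnj (z * f)\<close> sends \<open>basic k\<close> to
  \<open>c * basic (n - 1 - k)\<close> for \<open>k < n\<close>.
\<close>
lemma \<theta>_mult_cnj_basic:
  assumes "norm z = 1" "k \<le> n"
  shows "\<theta> z * cnj (basic k z) = c * basic (n - k) z"
proof -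
  have "z * cnj z = 1"
    using assms(1) by (simp add: complex_norm_square[symmetric])
  have ne: "denom z \<noteq> 0" using denom_nonzero assms by simp
  have "z ^ n * cnj (denom z) = (\<Prod>k<n. z * cnj (1 - cnj (a k) * z))"
    by (simp add: denom_def prod.distrib)
  also have "\<dots> = (\<Prod>k<n. z - a k)"
    using \<open>z * cnj z = 1\<close> by (intro prod.cong) (auto simp: algebra_simps)
  finally have "\<theta> z = c * (z ^ n * cnj (denom z)) / denom z"
    using assms by (simp add: \<theta>_eq_div_denom)
  moreover have "z ^ n * cnj (z ^ k) = z ^ (n - k)"
  proof -
    have "z ^ n = z ^ (n - k) * z ^ k" using assms(2) by (simp flip: power_add)
    then have "z ^ n * cnj (z ^ k) = z ^ (n - k) * (z * cnj z) ^ k"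
      by (simp add: power_mult_distrib)
    then show ?thesis using \<open>z * cnj z = 1\<close> by simp
  qed
  ultimately have "\<theta> z * cnj (z ^ k) = c * z ^ (n - k) * cnj (denom z) / denom z"
    by (simp add: mult_ac)
  then show ?thesis
    using ne by (simp add: basic_def)
qed

lemma model_spaceD:
  assumes "f \<in> model_space \<theta>"
  shows "f \<in> hardy2" "f \<in> L2_circle"
  using assms hardy2D(1) by (auto simp: model_space_def)

text \<open>
  The inner product with \<open>\<theta> * g\<close> is, up to conjugation, the mean over the circle of the Hardy
  function \<open>c * basic (n - k) * g\<close>.  That mean is the value at the centre, where \<open>z ^ (n - k)\<close>
  vanishes because \<open>k < n\<close>.
\<close>
lemma basic_model_space:
  assumes "k < n"
  shows "basic k \<in> model_space \<theta>"
proof -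
  have "L2_inner (basic k) (\<lambda>z. \<theta> z * g z) = 0" if g: "g \<in> hardy2" for g
  proof -
    define h where "h = (\<lambda>z. c * basic (n - k) z * g z)"
    have "h \<in> hardy2"
      unfolding h_def
      by (intro disc_algebra_mult_hardy2 disc_algebra_mult disc_algebra_const basic_disc_algebra g)
    have "L2_inner (\<lambda>z. \<theta> z * g z) (basic k) = (LINT z|circle_measure. h z * (z / (z - 0)))"
      unfolding L2_inner_def
    proof (rule Bochner_Integration.integral_cong[OF refl])
      fix z assume "z \<in> space circle_measure"
      then have "norm z = 1" "z \<noteq> 0" by auto
      then show "\<theta> z * g z * cnj (basic k z) = h z * (z / (z - 0))"
        using \<theta>_mult_cnj_basic[of z k] assms by (simp add: h_def mult_ac)
    qed
    also have "\<dots> = h 0"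
      by (rule hardy2_Cauchy_formula[OF \<open>h \<in> hardy2\<close>]) simp
    also have "\<dots> = 0"
      using assms by (simp add: h_def basic_def)
    finally show ?thesis by (subst L2_inner_commute) simp
  qed
  then show ?thesis
    using disc_algebra_subset_hardy2[OF basic_disc_algebra] by (simp add: model_space_def)
qed

lemma model_space_lincomb:
  assumes "\<And>j. j \<in> J \<Longrightarrow> f j \<in> model_space \<theta>"
  shows "(\<lambda>z. \<Sum>j\<in>J. x j * f j z) \<in> model_space \<theta>"
proof -
  have "L2_inner (\<lambda>z. \<Sum>j\<in>J. x j * f j z) (\<lambda>z. \<theta> z * g z) = 0" if "g \<in> hardy2" for g
    using assms that
    by (subst L2_inner_sum_left)
       (auto simp: model_space_def intro: hardy2D(1) L2_circle_mult[OF \<theta>_Linf_circle])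
  then show ?thesis
    using assms by (auto simp: model_space_def intro!: hardy2_sum hardy2_cmult)
qed

end

section \<open>Linear algebra and interpolation\<close>

(* From here on the dollar sign is indexing of vectors whose dimension is a number. *)
unbundle no vec_syntax

lemma zero_coefficients_of_zero_on_disc:
  fixes x :: "nat \<Rightarrow> complex"
  assumes "\<And>w. norm w < 1 \<Longrightarrow> (\<Sum>k<n. x k * w ^ k) = 0" and "k < n"
  shows "x k = 0"
proof -
  define p where "p = (\<Sum>k<n. Polynomial.monom (x k) k)"
  have "poly p w = 0" if "w \<in> ball 0 1" for w
    using assms(1)[of w] that by (simp add: p_def poly_sum poly_monom)
  then have "ball 0 1 \<subseteq> {w. poly p w = 0}" by auto
  moreover have "infinite (ball 0 1 :: complex set)"
    by (intro uncountable_infinite uncountable_ball) simp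
  ultimately have "p = 0"
    using poly_roots_finite[of p] finite_subset by blast
  moreover have "Polynomial.coeff p k = x k"
    using \<open>k < n\<close> by (simp add: p_def coeff_sum)
  ultimately show ?thesis by simp
qed

text \<open>
  A square matrix whose rows are linearly independent is invertible, phrased with plain double
  sequences so that it applies directly to coefficients of expansions.
\<close>
lemma left_inverse_of_independent_rows:
  fixes C :: "nat \<Rightarrow> nat \<Rightarrow> 'a::field"
  assumes indep: "\<And>x. (\<And>j. j < n \<Longrightarrow> (\<Sum>k<n. x k * C k j) = 0) \<Longrightarrow> (\<And>k. k < n \<Longrightarrow> x k = 0)"
  obtains D where "\<And>i j. i < n \<Longrightarrow> j < n \<Longrightarrow> (\<Sum>k<n. D i k * C k j) = (if i = j then 1 else 0)"
proof -
  define A where "A = Matrix.mat n n (\<lambda>(k, j). C k j)"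
  have A: "A \<in> carrier_mat n n" by (simp add: A_def)
  have "Determinant.det (transpose_mat A) \<noteq> 0"
  proof
    assume "Determinant.det (transpose_mat A) = 0"
    then obtain x where x: "x \<in> carrier_vec n" "x \<noteq> 0\<^sub>v n" "transpose_mat A *\<^sub>v x = 0\<^sub>v n"
      using det_0_iff_vec_prod_zero_field[of "transpose_mat A" n] A by auto
    have "(\<Sum>k<n. x $ k * C k j) = 0" if "j < n" for j
    proof -
      have "(transpose_mat A *\<^sub>v x) $ j = 0"
        using x(3) that by simp
      then show ?thesis
        using that x(1) A by (simp add: scalar_prod_def A_def atLeast0LessThan mult.commute)
    qed
    then have "x $ k = 0" if "k < n" for k
      using indep[of "\<lambda>k. x $ k"] that by blast
    then have "x = 0\<^sub>v n"
      using x(1) by (intro eq_vecI) auto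
    with x(2) show False by simp
  qed
  then have "Determinant.det A \<noteq> 0"
    using det_transpose[OF A] by simp
  from det_non_zero_imp_unit[OF A this, of "()"]
  obtain B where B: "B * A = 1\<^sub>m n" "B \<in> carrier_mat n n"
    unfolding Units_def ring_mat_def by auto
  show thesis
  proof
    fix i j assume ij: "i < n" "j < n"
    have "(B * A) $$ (i, j) = (if i = j then 1 else 0)"
      using B(1) ij by simp
    then show "(\<Sum>k<n. B $$ (i, k) * C k j) = (if i = j then 1 else 0)"
      using ij B(2) A by (simp add: scalar_prod_def A_def atLeast0LessThan)
  qed
qed

definition lagrange_basis :: "nat \<Rightarrow> (nat \<Rightarrow> 'a::field) \<Rightarrow> nat \<Rightarrow> 'a poly" where
  "lagrange_basis m lam l = (\<Prod>s\<in>{..<m} - {l}. Polynomial.smult (inverse (lam l - lam s)) [:- lam s, 1:])"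

lemma poly_lagrange_basis:
  fixes lam :: "nat \<Rightarrow> 'a::field"
  assumes "inj_on lam {..<m}" "l < m" "s < m"
  shows "poly (lagrange_basis m lam l) (lam s) = (if s = l then 1 else 0)"
proof (cases "s = l")
  case True
  have "poly (lagrange_basis m lam l) (lam l)
      = (\<Prod>s\<in>{..<m} - {l}. inverse (lam l - lam s) * (lam l - lam s))"
    by (simp add: lagrange_basis_def poly_prod algebra_simps)
  also have "\<dots> = (\<Prod>s\<in>{..<m} - {l}. 1)"
  proof (rule prod.cong[OF refl])
    fix s assume "s \<in> {..<m} - {l}"
    then have "lam l \<noteq> lam s" using assms by (auto dest: inj_onD)
    then show "inverse (lam l - lam s) * (lam l - lam s) = 1" by simp
  qed
  finally show ?thesis using True by simp
next
  case False
  then show ?thesis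
    using assms by (auto simp: lagrange_basis_def poly_prod intro!: bexI[of _ s])
qed

lemma degree_lagrange_basis:
  assumes "l < m"
  shows "Polynomial.degree (lagrange_basis m lam l) < m"
proof -
  have "Polynomial.degree (lagrange_basis m lam l) \<le> (\<Sum>s\<in>{..<m} - {l}. 1)"
    unfolding lagrange_basis_def
    by (rule order_trans[OF degree_prod_sum_le sum_mono])
       (auto intro: order_trans[OF degree_smult_le])
  then show ?thesis using assms by simp
qed

lemma lagrange_interpolation:
  fixes p :: "'a::field poly"
  assumes "inj_on lam {..<m}" "Polynomial.degree p < m"
  shows "p = (\<Sum>l<m. Polynomial.smult (poly p (lam l)) (lagrange_basis m lam l))"
proof (rule poly_eqI_degree[where A = "lam ` {..<m}"])
  fix x assume "x \<in> lam ` {..<m}"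
  then obtain s where s: "s < m" "x = lam s" by auto
  have "poly (\<Sum>l<m. Polynomial.smult (poly p (lam l)) (lagrange_basis m lam l)) x
      = (\<Sum>l<m. if s = l then poly p (lam s) else 0)"
    unfolding poly_sum using s assms(1)
    by (intro sum.cong) (auto simp: poly_lagrange_basis)
  then show "poly p x = poly (\<Sum>l<m. Polynomial.smult (poly p (lam l)) (lagrange_basis m lam l)) x"
    using s by simp
next
  have "Polynomial.degree (\<Sum>l<m. Polynomial.smult (poly p (lam l)) (lagrange_basis m lam l)) \<le> m - 1"
    using degree_lagrange_basis[of _ m lam]
    by (intro degree_sum_le) (fastforce intro: order_trans[OF degree_smult_le])+
  then show "Polynomial.degree (\<Sum>l<m. Polynomial.smult (poly p (lam l)) (lagrange_basis m lam l))
      < card (lam ` {..<m})"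
    using assms by (simp add: card_image)
qed (use assms in \<open>simp add: card_image\<close>)

section \<open>Vectorialisation\<close>

text \<open>
  The positions on and above the diagonal in the order in which the vectorialisation lists them.
  Mapping over this list turns
  statements about coordinates of a vectorialisation into statements about pairs of indices.
\<close>
definition upper_pairs :: "nat \<Rightarrow> (nat \<times> nat) list" where
  "upper_pairs n = concat (map (\<lambda>i. map (Pair i) [i..<n]) [0..<n])"

lemma set_upper_pairs: "set (upper_pairs n) = {(i, j). i \<le> j \<and> j < n}"
  by (auto simp: upper_pairs_def image_iff)

lemma length_upper_pairs: "length (upper_pairs n) = n * (n + 1) div 2"
proof -
  have "length (upper_pairs n) = (\<Sum>i<n. n - i)"
    by (simp add: upper_pairs_def length_concat o_def interv_sum_list_conv_sum_set_nat atLeast0LessThan)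
  also have "\<dots> = (\<Sum>i<n. Suc i)"
  proof -
    have "(\<Sum>i<n. Suc i) = (\<Sum>i<n. n - (n - Suc i))"
      by (intro sum.cong) auto
    then show ?thesis by (simp only: sum.nat_diff_reindex)
  qed
  also have "\<dots> = n * (n + 1) div 2"
    by (induction n) auto
  finally show ?thesis .
qed

lemma vectorialise_eq:
  assumes "M \<in> carrier_mat n n"
  shows "vectorialise M = vec_of_list (map (\<lambda>p. M $$ p) (upper_pairs n))"
  using assms by (simp add: vectorialise_def upper_pairs_def map_concat o_def)

text \<open>
  The kernel of a matrix of vectorialisations consists of the linear relations that hold at all
  positions on and above the diagonal.
\<close>
lemma mat_of_cols_vectorialise_mult_eq_0:
  fixes Ms :: "complex mat list"
  assumes Ms: "\<And>M. M \<in> set Ms \<Longrightarrow> M \<in> carrier_mat n n" and x: "x \<in> carrier_vec (length Ms)"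
  shows "mat_of_cols (n * (n + 1) div 2) (map vectorialise Ms) *\<^sub>v x = 0\<^sub>v (n * (n + 1) div 2) \<longleftrightarrow>
    (\<forall>i j. i \<le> j \<and> j < n \<longrightarrow> (\<Sum>l<length Ms. x $ l * (Ms ! l) $$ (i, j)) = 0)"
proof -
  define N where "N = n * (n + 1) div 2"
  have N: "length (upper_pairs n) = N" by (simp add: N_def length_upper_pairs)
  have entry: "(mat_of_cols N (map vectorialise Ms) *\<^sub>v x) $ t
      = (\<Sum>l<length Ms. x $ l * (Ms ! l) $$ (upper_pairs n ! t))" if "t < N" for t
  proof -
    have "vectorialise (Ms ! l) $ t = (Ms ! l) $$ (upper_pairs n ! t)" if "l < length Ms" for l
      using vectorialise_eq[OF Ms, of "Ms ! l"] that \<open>t < N\<close> N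
      by (simp add: vec_of_list_index del: vec_of_list_map)
    then show ?thesis
      using that x by (auto simp: scalar_prod_def mat_of_cols_index atLeast0LessThan intro!: sum.cong)
  qed
  have "mat_of_cols N (map vectorialise Ms) *\<^sub>v x = 0\<^sub>v N \<longleftrightarrow>
      (\<forall>t<N. (mat_of_cols N (map vectorialise Ms) *\<^sub>v x) $ t = 0)"
    (is "?u = _ \<longleftrightarrow> _")
  proof
    assume "?u = 0\<^sub>v N"
    then show "\<forall>t<N. ?u $ t = 0" by (simp only: index_zero_vec) simp
  next
    assume "\<forall>t<N. ?u $ t = 0"
    then show "?u = 0\<^sub>v N" by (intro eq_vecI) simp_all
  qed
  also have "\<dots> \<longleftrightarrow> (\<forall>p\<in>set (upper_pairs n). (\<Sum>l<length Ms. x $ l * (Ms ! l) $$ p) = 0)"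
    by (simp add: entry all_set_conv_all_nth N del: index_mult_mat_vec)
  also have "\<dots> \<longleftrightarrow> (\<forall>i j. i \<le> j \<and> j < n \<longrightarrow> (\<Sum>l<length Ms. x $ l * (Ms ! l) $$ (i, j)) = 0)"
    by (auto simp: set_upper_pairs)
  finally show ?thesis by (simp add: N_def)
qed

section \<open>Products of basis functions\<close>

locale model_basis = finite_blaschke +
  fixes v :: "nat \<Rightarrow> complex \<Rightarrow> complex"
  assumes onb: "model_onb n \<theta> v"
begin

lemma v_model_space: "j < n \<Longrightarrow> v j \<in> model_space \<theta>"
  using onb by (simp add: model_onb_def)

lemma v_hardy2: "j < n \<Longrightarrow> v j \<in> hardy2"
  and v_L2_circle: "j < n \<Longrightarrow> v j \<in> L2_circle"
  using v_model_space model_spaceD by auto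

lemma v_orthonormal: "i < n \<Longrightarrow> j < n \<Longrightarrow> L2_inner (v i) (v j) = (if i = j then 1 else 0)"
  using onb by (simp add: model_onb_def)

lemma basic_hardy2: "basic k \<in> hardy2"
  by (rule disc_algebra_subset_hardy2[OF basic_disc_algebra])

text \<open>
  Completeness of the orthonormal basis only gives the expansion almost everywhere on the circle.
  It extends to the disc since boundary values determine a Hardy function.
\<close>
lemma basic_in_span:
  obtains C where "\<And>k. k < n \<Longrightarrow> AE z in circle_measure. basic k z = (\<Sum>j<n. C k j * v j z)"
    and "\<And>k w. k < n \<Longrightarrow> norm w < 1 \<Longrightarrow> basic k w = (\<Sum>j<n. C k j * v j w)"
proof -
  have "\<exists>x. AE z in circle_measure. basic k z = (\<Sum>j<n. x j * v j z)" if "k < n" for k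
    using onb basic_model_space[OF that] by (simp add: model_onb_def)
  then obtain C where C: "\<And>k. k < n \<Longrightarrow> AE z in circle_measure. basic k z = (\<Sum>j<n. C k j * v j z)"
    by metis
  moreover have "basic k w = (\<Sum>j<n. C k j * v j w)" if "k < n" "norm w < 1" for k w
    by (rule hardy2_eq_on_disc[OF _ _ C[OF that(1)] that(2)])
       (auto intro!: basic_hardy2 hardy2_sum hardy2_cmult v_hardy2)
  ultimately show thesis by (rule that)
qed

text \<open>
  A dimension count: the \<open>n\<close> functions \<open>basic k\<close> are combinations of the \<open>n\<close> functions \<open>v j\<close>, and they
  are linearly independent, so the coefficient matrix is invertible and the expansion can be solved
  for the \<open>v j\<close>.  The same coefficients serve on the circle and in the disc.
\<close>
lemma v_eq_poly_div_denom:
  obtains p where "\<And>i. i < n \<Longrightarrow> Polynomial.degree (p i) < n"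
    and "\<And>i. i < n \<Longrightarrow> AE z in circle_measure. v i z = poly (p i) z / denom z"
    and "\<And>i w. i < n \<Longrightarrow> norm w < 1 \<Longrightarrow> v i w = poly (p i) w / denom w"
proof -
  obtain C where C: "\<And>k. k < n \<Longrightarrow> AE z in circle_measure. basic k z = (\<Sum>j<n. C k j * v j z)"
    and C_disc: "\<And>k w. k < n \<Longrightarrow> norm w < 1 \<Longrightarrow> basic k w = (\<Sum>j<n. C k j * v j w)"
    by (rule basic_in_span) blast
  have "x k = 0" if x: "\<And>j. j < n \<Longrightarrow> (\<Sum>k<n. x k * C k j) = 0" and "k < n" for x k
  proof (rule zero_coefficients_of_zero_on_disc[OF _ \<open>k < n\<close>])
    fix w :: complex assume w: "norm w < 1"
    have "(\<Sum>k<n. x k * w ^ k) / denom w = (\<Sum>k<n. x k * basic k w)"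
      by (simp add: basic_def sum_divide_distrib)
    also have "\<dots> = (\<Sum>k<n. \<Sum>j<n. x k * C k j * v j w)"
      using w by (simp add: C_disc sum_distrib_left mult.assoc)
    also have "\<dots> = (\<Sum>j<n. (\<Sum>k<n. x k * C k j) * v j w)"
      by (subst sum.swap) (simp add: sum_distrib_right)
    also have "\<dots> = 0"
      using x by simp
    finally show "(\<Sum>k<n. x k * w ^ k) = 0"
      using denom_nonzero[of w] w by simp
  qed
  then obtain D where D: "\<And>i j. i < n \<Longrightarrow> j < n \<Longrightarrow> (\<Sum>k<n. D i k * C k j) = (if i = j then 1 else 0)"
    using left_inverse_of_independent_rows[of n C] by blast
  define p where "p = (\<lambda>i. \<Sum>k<n. Polynomial.monom (D i k) k)"
  have inverted: "v i z = poly (p i) z / denom z"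
    if "i < n" and z: "\<forall>k<n. basic k z = (\<Sum>j<n. C k j * v j z)" for i z
  proof -
    have "poly (p i) z / denom z = (\<Sum>k<n. D i k * basic k z)"
      by (simp add: p_def poly_sum poly_monom basic_def sum_divide_distrib)
    also have "\<dots> = (\<Sum>k<n. \<Sum>j<n. D i k * C k j * v j z)"
      using z by (simp add: sum_distrib_left mult.assoc)
    also have "\<dots> = (\<Sum>j<n. (\<Sum>k<n. D i k * C k j) * v j z)"
      by (subst sum.swap) (simp add: sum_distrib_right)
    also have "\<dots> = (\<Sum>j<n. if i = j then v i z else 0)"
      using \<open>i < n\<close> by (intro sum.cong) (auto simp: D)
    also have "\<dots> = v i z"
      using \<open>i < n\<close> by simp
    finally show ?thesis by simp
  qed
  have all_k: "AE z in circle_measure. \<forall>k\<in>{..<n}. basic k z = (\<Sum>j<n. C k j * v j z)"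
    using C by (intro AE_finite_allI) auto
  show thesis
  proof
    show "Polynomial.degree (p i) < n" if "i < n" for i
    proof -
      have "Polynomial.degree (p i) \<le> n - 1"
        unfolding p_def by (intro degree_sum_le) (auto intro: order_trans[OF degree_monom_le])
      then show ?thesis using that by simp
    qed
    show "AE z in circle_measure. v i z = poly (p i) z / denom z" if "i < n" for i
      using all_k by eventually_elim (auto intro: inverted[OF that])
    show "v i w = poly (p i) w / denom w" if "i < n" "norm w < 1" for i w
      using that by (intro inverted) (auto simp: C_disc)
  qed
qed

lemma product_extension:
  assumes "i < n" "j < n"
  obtains P where "Polynomial.degree P < 2 * n - 1"
    and "AE z in circle_measure. v i z * v j z = poly P z / (denom z)\<^sup>2"
    and "\<And>w. norm w < 1 \<Longrightarrow> v i w * v j w = poly P w / (denom w)\<^sup>2"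
proof -
  obtain p where deg: "\<And>i. i < n \<Longrightarrow> Polynomial.degree (p i) < n"
    and circ: "\<And>i. i < n \<Longrightarrow> AE z in circle_measure. v i z = poly (p i) z / denom z"
    and disc: "\<And>i w. i < n \<Longrightarrow> norm w < 1 \<Longrightarrow> v i w = poly (p i) w / denom w"
    by (rule v_eq_poly_div_denom) blast
  show thesis
  proof
    show "Polynomial.degree (p i * p j) < 2 * n - 1"
      using degree_mult_le[of "p i" "p j"] deg[OF assms(1)] deg[OF assms(2)] by linarith
    show "AE z in circle_measure. v i z * v j z = poly (p i * p j) z / (denom z)\<^sup>2"
      using circ[OF assms(1)] circ[OF assms(2)] by eventually_elim (simp add: power2_eq_square)
    show "v i w * v j w = poly (p i * p j) w / (denom w)\<^sup>2" if "norm w < 1" for w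
      using assms disc that by (simp add: power2_eq_square)
  qed
qed

lemma poly_div_denom_square_disc_algebra: "(\<lambda>z. poly P z / (denom z)\<^sup>2) \<in> disc_algebra"
  using disc_algebra_mult[OF poly_div_denom_disc_algebra[of P] poly_div_denom_disc_algebra[of 1]]
  by (simp add: power2_eq_square)

text \<open>
  The numerators of the products have degree at most \<open>2 * n - 2\<close>, so they are recovered from their
  values at \<open>2 * n - 1\<close> points by Lagrange interpolation; \<open>R l\<close> is the Lagrange basis polynomial,
  divided by \<open>(denom z)\<^sup>2\<close> and scaled by the value of this denominator at the node.
\<close>
lemma products_interpolation:
  assumes lam: "inj_on lam {..<2 * n - 1}" "\<And>l. l < 2 * n - 1 \<Longrightarrow> norm (lam l) < 1"
  obtains R where "\<And>l. l < 2 * n - 1 \<Longrightarrow> R l \<in> disc_algebra"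
    and "\<And>i j. i < n \<Longrightarrow> j < n \<Longrightarrow>
      AE z in circle_measure. v i z * v j z = (\<Sum>l<2 * n - 1. v i (lam l) * v j (lam l) * R l z)"
proof
  define R where "R = (\<lambda>l z. (denom (lam l))\<^sup>2 * (poly (lagrange_basis (2 * n - 1) lam l) z / (denom z)\<^sup>2))"
  show "R l \<in> disc_algebra" for l
    unfolding R_def by (intro disc_algebra_mult disc_algebra_const poly_div_denom_square_disc_algebra)
  fix i j assume ij: "i < n" "j < n"
  obtain P where P: "Polynomial.degree P < 2 * n - 1"
    and circ: "AE z in circle_measure. v i z * v j z = poly P z / (denom z)\<^sup>2"
    and disc: "\<And>w. norm w < 1 \<Longrightarrow> v i w * v j w = poly P w / (denom w)\<^sup>2"
    by (rule product_extension[OF ij]) blast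
  have "poly P z / (denom z)\<^sup>2 = (\<Sum>l<2 * n - 1. v i (lam l) * v j (lam l) * R l z)" for z
  proof -
    have "poly P z = (\<Sum>l<2 * n - 1. poly P (lam l) * poly (lagrange_basis (2 * n - 1) lam l) z)"
      by (subst lagrange_interpolation[OF lam(1) P]) (simp add: poly_sum)
    also have "\<dots> = (\<Sum>l<2 * n - 1. v i (lam l) * v j (lam l) * (denom (lam l))\<^sup>2
        * poly (lagrange_basis (2 * n - 1) lam l) z)"
      using lam(2) denom_nonzero by (intro sum.cong) (auto simp: disc less_imp_le)
    finally show ?thesis
      by (simp add: R_def sum_divide_distrib mult.assoc)
  qed
  then show "AE z in circle_measure. v i z * v j z = (\<Sum>l<2 * n - 1. v i (lam l) * v j (lam l) * R l z)"
    using circ by simp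
qed

text \<open>
  The products \<open>basic k * basic k'\<close> lie in the span of the products \<open>v i * v j\<close>, and they are all the
  functions \<open>z\<^sup>t / (denom z)\<^sup>2\<close> with \<open>t \<le> 2 * n - 2\<close>.  A relation between the evaluations thus holds for
  every numerator of degree at most \<open>2 * n - 2\<close>, in particular for the Lagrange basis polynomials,
  each of which isolates one coefficient.
\<close>
lemma evaluations_independent:
  assumes lam: "inj_on lam {..<2 * n - 1}" "\<And>l. l < 2 * n - 1 \<Longrightarrow> norm (lam l) < 1"
    and zero: "\<And>i j. i < n \<Longrightarrow> j < n \<Longrightarrow> (\<Sum>l<2 * n - 1. x l * (v i (lam l) * v j (lam l))) = 0"
    and "s < 2 * n - 1"
  shows "x s = 0"
proof -
  obtain C where C: "\<And>k w. k < n \<Longrightarrow> norm w < 1 \<Longrightarrow> basic k w = (\<Sum>j<n. C k j * v j w)"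
    by (rule basic_in_span) blast
  have basic_zero: "(\<Sum>l<2 * n - 1. x l * (basic k (lam l) * basic k' (lam l))) = 0"
    if k: "k < n" "k' < n" for k k'
  proof -
    have "(\<Sum>l<2 * n - 1. x l * (basic k (lam l) * basic k' (lam l)))
        = (\<Sum>l<2 * n - 1. \<Sum>i<n. \<Sum>j<n. C k i * C k' j * (x l * (v i (lam l) * v j (lam l))))"
      using k lam(2) by (intro sum.cong) (auto simp: C sum_product sum_distrib_left mult_ac)
    also have "\<dots> = (\<Sum>i<n. \<Sum>j<n. \<Sum>l<2 * n - 1. C k i * C k' j * (x l * (v i (lam l) * v j (lam l))))"
      by (subst sum.swap) (intro sum.cong refl sum.swap)
    also have "\<dots> = 0"
      using zero by (simp flip: sum_distrib_left)
    finally show ?thesis .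
  qed
  have power_zero: "(\<Sum>l<2 * n - 1. x l / (denom (lam l))\<^sup>2 * lam l ^ t) = 0" if "t < 2 * n - 1" for t
  proof -
    \<comment> \<open>Any exponent up to \<open>2 * n - 2\<close> splits into two exponents below \<open>n\<close>.\<close>
    define k where "k = min t (n - 1)"
    have "k < n" "t - k < n" "t = k + (t - k)"
      using that by (auto simp: k_def)
    then show ?thesis
      using basic_zero[of k "t - k"]
      by (simp add: basic_def power2_eq_square flip: power_add)
  qed
  define P where "P = lagrange_basis (2 * n - 1) lam s"
  have "x s / (denom (lam s))\<^sup>2 = (\<Sum>l<2 * n - 1. if l = s then x s / (denom (lam s))\<^sup>2 else 0)"
    using \<open>s < 2 * n - 1\<close> by simp
  also have "\<dots> = (\<Sum>l<2 * n - 1. x l / (denom (lam l))\<^sup>2 * poly P (lam l))"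
    using lam(1) \<open>s < 2 * n - 1\<close> by (intro sum.cong) (auto simp: P_def poly_lagrange_basis)
  also have "\<dots> = (\<Sum>l<2 * n - 1. \<Sum>t\<le>Polynomial.degree P.
      Polynomial.coeff P t * (x l / (denom (lam l))\<^sup>2 * lam l ^ t))"
    by (simp add: poly_altdef sum_distrib_left mult_ac)
  also have "\<dots> = (\<Sum>t\<le>Polynomial.degree P. \<Sum>l<2 * n - 1.
      Polynomial.coeff P t * (x l / (denom (lam l))\<^sup>2 * lam l ^ t))"
    by (rule sum.swap)
  also have "\<dots> = (\<Sum>t\<le>Polynomial.degree P. 0)"
  proof (rule sum.cong[OF refl])
    fix t assume "t \<in> {..Polynomial.degree P}"
    then have "t < 2 * n - 1"
      using degree_lagrange_basis[OF \<open>s < 2 * n - 1\<close>, of lam] by (simp add: P_def)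
    then show "(\<Sum>l<2 * n - 1. Polynomial.coeff P t * (x l / (denom (lam l))\<^sup>2 * lam l ^ t)) = 0"
      by (simp only: sum_distrib_left[symmetric] power_zero) simp
  qed
  finally show ?thesis
    using denom_nonzero[of "lam s"] lam(2)[OF \<open>s < 2 * n - 1\<close>] by simp
qed

section \<open>Matrices of truncated Toeplitz operators\<close>

lemma L2_inner_lincomb_v:
  assumes "i < n"
  shows "L2_inner (\<lambda>z. \<Sum>j<n. x j * v j z) (v i) = x i"
proof -
  have "L2_inner (\<lambda>z. \<Sum>j<n. x j * v j z) (v i) = (\<Sum>j<n. x j * L2_inner (v j) (v i))"
    using assms by (intro L2_inner_sum_left v_L2_circle) auto
  also have "\<dots> = (\<Sum>j<n. if i = j then x i else 0)"
    using assms by (intro sum.cong) (auto simp: v_orthonormal)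
  finally show ?thesis using assms by simp
qed

lemma is_model_proj_expansion:
  assumes g: "g \<in> L2_circle"
  shows "is_model_proj \<theta> g (\<lambda>z. \<Sum>j<n. L2_inner g (v j) * v j z)"
proof -
  define h where "h = (\<lambda>z. \<Sum>j<n. L2_inner g (v j) * v j z)"
  have h: "h \<in> model_space \<theta>"
    unfolding h_def by (intro model_space_lincomb v_model_space) auto
  have gh: "(\<lambda>z. g z - h z) \<in> L2_circle"
    using L2_circle_add[OF g L2_circle_cmult[OF model_spaceD(2)[OF h], of "-1"]] by simp
  have orth: "L2_inner (\<lambda>z. g z - h z) (v j) = 0" if "j < n" for j
    using that g h v_L2_circle model_spaceD(2)
    by (simp add: L2_inner_diff_left) (simp add: h_def L2_inner_lincomb_v)
  have "L2_inner (\<lambda>z. g z - h z) k = 0" if k: "k \<in> model_space \<theta>" for k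
  proof -
    obtain x where x: "AE z in circle_measure. k z = (\<Sum>j<n. x j * v j z)"
      using onb k by (auto simp: model_onb_def)
    have "L2_inner (\<lambda>z. g z - h z) k = L2_inner (\<lambda>z. g z - h z) (\<lambda>z. \<Sum>j<n. x j * v j z)"
      using gh k x by (intro L2_inner_cong_AE L2_circle_sum L2_circle_cmult v_L2_circle)
        (auto intro: model_spaceD)
    also have "\<dots> = (\<Sum>j<n. cnj (x j) * L2_inner (\<lambda>z. g z - h z) (v j))"
      using gh by (intro L2_inner_sum_right v_L2_circle) auto
    also have "\<dots> = 0"
      using orth by simp
    finally show ?thesis .
  qed
  with h show ?thesis
    unfolding is_model_proj_def h_def by blast
qed

text \<open>
  The compression to the model space does not change inner products with the \<open>v i\<close>, so only the
  symbol matters.  For the converse, an operator with a given symbol is written down explicitly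
  through the expansion of the projection in the orthonormal basis.
\<close>
lemma matrix_rep_truncated_toeplitz_iff:
  assumes S: "S \<in> carrier_mat n n"
  shows "(\<exists>A. truncated_toeplitz \<theta> A \<and> matrix_rep n v A = S) \<longleftrightarrow>
    (\<exists>\<phi>\<in>Linf_circle. \<forall>i<n. \<forall>j<n. S $$ (i, j) = L2_inner (\<lambda>z. \<phi> z * v j z) (v i))"
proof
  assume "\<exists>A. truncated_toeplitz \<theta> A \<and> matrix_rep n v A = S"
  then obtain A \<phi> where \<phi>: "\<phi> \<in> Linf_circle"
    and A: "\<And>f. f \<in> model_space \<theta> \<Longrightarrow> is_model_proj \<theta> (\<lambda>z. \<phi> z * f z) (A f)"
    and S_eq: "S = matrix_rep n v A"
    by (auto simp: truncated_toeplitz_def)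
  have "S $$ (i, j) = L2_inner (\<lambda>z. \<phi> z * v j z) (v i)" if "i < n" "j < n" for i j
  proof -
    have proj: "A (v j) \<in> model_space \<theta>" "L2_inner (\<lambda>z. \<phi> z * v j z - A (v j) z) (v i) = 0"
      using A[OF v_model_space[OF \<open>j < n\<close>]] v_model_space[OF \<open>i < n\<close>] by (auto simp: is_model_proj_def)
    have "L2_inner (\<lambda>z. \<phi> z * v j z) (v i) - L2_inner (A (v j)) (v i) = 0"
      using that proj by (subst L2_inner_diff_left[symmetric])
        (auto intro: L2_circle_mult[OF \<phi>] v_L2_circle model_spaceD)
    then show ?thesis
      using that by (simp add: S_eq matrix_rep_def)
  qed
  with \<phi> show "\<exists>\<phi>\<in>Linf_circle. \<forall>i<n. \<forall>j<n. S $$ (i, j) = L2_inner (\<lambda>z. \<phi> z * v j z) (v i)"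
    by blast
next
  assume "\<exists>\<phi>\<in>Linf_circle. \<forall>i<n. \<forall>j<n. S $$ (i, j) = L2_inner (\<lambda>z. \<phi> z * v j z) (v i)"
  then obtain \<phi> where \<phi>: "\<phi> \<in> Linf_circle"
    and entry: "\<And>i j. i < n \<Longrightarrow> j < n \<Longrightarrow> S $$ (i, j) = L2_inner (\<lambda>z. \<phi> z * v j z) (v i)"
    by blast
  define A where "A = (\<lambda>f z. \<Sum>j<n. L2_inner (\<lambda>z. \<phi> z * f z) (v j) * v j z)"
  have "truncated_toeplitz \<theta> A"
    unfolding truncated_toeplitz_def A_def
    using \<phi> by (intro bexI[of _ \<phi>] ballI is_model_proj_expansion L2_circle_mult model_spaceD)
  moreover have "matrix_rep n v A = S"
    using S by (intro eq_matI) (auto simp: matrix_rep_def A_def L2_inner_lincomb_v entry)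
  ultimately show "\<exists>A. truncated_toeplitz \<theta> A \<and> matrix_rep n v A = S"
    by blast
qed

end

locale conj_real_model_basis = model_basis +
  assumes conj_real: "j < n \<Longrightarrow> AE z in circle_measure. model_conj \<theta> (v j) z = v j z"
begin

text \<open>
  This is where the basis has to be real for the conjugation: substituting
  \<open>v j = \<theta> * cnj (z * v j)\<close> makes the entry depend on \<open>i\<close> and \<open>j\<close> only through the product
  \<open>v i * v j\<close>.  The function \<open>G\<close> stands for any bounded representative of that product.
\<close>
lemma symbol_entry:
  assumes "i < n" "j < n" and \<phi>: "\<phi> \<in> Linf_circle" and G: "G \<in> Linf_circle"
    and prod: "AE z in circle_measure. v i z * v j z = G z"
  shows "L2_inner (\<lambda>z. \<phi> z * v j z) (v i) = L2_inner (\<lambda>z. \<phi> z * (\<theta> z * cnj z)) G"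
  unfolding L2_inner_def
proof (rule integral_cong_AE)
  have "(\<lambda>z. \<theta> z * cnj z) \<in> L2_circle"
    by (intro Linf_circle_subset_L2_circle continuous_on_sphere_Linf_circle continuous_intros
        continuous_on_\<theta>)
  then show "(\<lambda>z. \<phi> z * (\<theta> z * cnj z) * cnj (G z)) \<in> borel_measurable circle_measure"
    by (intro borel_measurable_integrable
        L2_circle_integrable_inner[OF L2_circle_mult[OF \<phi>] Linf_circle_subset_L2_circle[OF G]])
  show "(\<lambda>z. \<phi> z * v j z * cnj (v i z)) \<in> borel_measurable circle_measure"
    by (intro borel_measurable_integrable L2_circle_integrable_inner L2_circle_mult \<phi>
        v_L2_circle assms)
  show "AE z in circle_measure. \<phi> z * v j z * cnj (v i z) = \<phi> z * (\<theta> z * cnj z) * cnj (G z)"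
    using prod conj_real[OF \<open>j < n\<close>]
  proof eventually_elim
    case (elim z)
    have "\<phi> z * v j z * cnj (v i z) = \<phi> z * (\<theta> z * cnj (z * v j z)) * cnj (v i z)"
      using elim(2) by (simp add: model_conj_def)
    also have "\<dots> = \<phi> z * (\<theta> z * cnj z) * cnj (v i z * v j z)"
      by (simp add: mult_ac)
    finally show ?case by (simp only: elim(1))
  qed
qed

text \<open>
  For a given symbol, interpolation of \<open>v i * v j\<close> expresses all entries through the values at the
  nodes.  For given coefficients, the symbol is chosen such that \<open>\<phi> * \<theta> * cnj z\<close> is the combination
  of conjugated Cauchy kernels, which evaluate \<open>v i * v j\<close> at the nodes.
\<close>
lemma symbol_iff_evaluations:
  assumes lam: "inj_on lam {..<2 * n - 1}" "\<And>l. l < 2 * n - 1 \<Longrightarrow> norm (lam l) < 1"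
  shows "(\<exists>\<phi>\<in>Linf_circle. \<forall>i<n. \<forall>j<n. s i j = L2_inner (\<lambda>z. \<phi> z * v j z) (v i)) \<longleftrightarrow>
    (\<exists>\<beta>. \<forall>i<n. \<forall>j<n. s i j = (\<Sum>l<2 * n - 1. \<beta> l * cnj (v i (lam l) * v j (lam l))))"
proof
  assume "\<exists>\<phi>\<in>Linf_circle. \<forall>i<n. \<forall>j<n. s i j = L2_inner (\<lambda>z. \<phi> z * v j z) (v i)"
  then obtain \<phi> where \<phi>: "\<phi> \<in> Linf_circle"
    and s: "\<And>i j. i < n \<Longrightarrow> j < n \<Longrightarrow> s i j = L2_inner (\<lambda>z. \<phi> z * v j z) (v i)"
    by blast
  obtain R where R: "\<And>l. l < 2 * n - 1 \<Longrightarrow> R l \<in> disc_algebra"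
    and prod: "\<And>i j. i < n \<Longrightarrow> j < n \<Longrightarrow>
      AE z in circle_measure. v i z * v j z = (\<Sum>l<2 * n - 1. v i (lam l) * v j (lam l) * R l z)"
    by (rule products_interpolation[OF lam]) blast+
  define \<psi> where "\<psi> = (\<lambda>z. \<phi> z * (\<theta> z * cnj z))"
  have \<psi>: "\<psi> \<in> L2_circle"
    unfolding \<psi>_def
    by (intro L2_circle_mult[OF \<phi>] Linf_circle_subset_L2_circle continuous_on_sphere_Linf_circle
        continuous_intros continuous_on_\<theta>)
  have R_cont: "continuous_on (sphere 0 1) (R l)" if "l < 2 * n - 1" for l
    using R[OF that] by (auto simp: disc_algebra_def intro: continuous_on_subset)
  have "s i j = (\<Sum>l<2 * n - 1. L2_inner \<psi> (R l) * cnj (v i (lam l) * v j (lam l)))"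
    if ij: "i < n" "j < n" for i j
  proof -
    have "s i j = L2_inner \<psi> (\<lambda>z. \<Sum>l<2 * n - 1. v i (lam l) * v j (lam l) * R l z)"
      unfolding s[OF ij] \<psi>_def
      by (intro symbol_entry ij \<phi> prod continuous_on_sphere_Linf_circle continuous_intros R_cont) auto
    also have "\<dots> = (\<Sum>l<2 * n - 1. cnj (v i (lam l) * v j (lam l)) * L2_inner \<psi> (R l))"
      by (intro L2_inner_sum_right \<psi> Linf_circle_subset_L2_circle disc_algebra_Linf_circle R) auto
    finally show ?thesis by (simp add: mult.commute)
  qed
  then show "\<exists>\<beta>. \<forall>i<n. \<forall>j<n. s i j = (\<Sum>l<2 * n - 1. \<beta> l * cnj (v i (lam l) * v j (lam l)))"
    by (intro exI[of _ "\<lambda>l. L2_inner \<psi> (R l)"]) blast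
next
  assume "\<exists>\<beta>. \<forall>i<n. \<forall>j<n. s i j = (\<Sum>l<2 * n - 1. \<beta> l * cnj (v i (lam l) * v j (lam l)))"
  then obtain \<beta> where s: "\<And>i j. i < n \<Longrightarrow> j < n \<Longrightarrow>
      s i j = (\<Sum>l<2 * n - 1. \<beta> l * cnj (v i (lam l) * v j (lam l)))"
    by blast
  define \<psi> where "\<psi> = (\<lambda>z. \<Sum>l<2 * n - 1. \<beta> l * cnj (z / (z - lam l)))"
  \<comment> \<open>Dividing by \<open>\<theta> * cnj z\<close> is multiplying by its conjugate, since both factors are unimodular.\<close>
  define \<phi> where "\<phi> = (\<lambda>z. cnj (\<theta> z) * z * \<psi> z)"
  have kernel: "continuous_on (sphere 0 1) (\<lambda>z. cnj (z / (z - lam l)))" if "l < 2 * n - 1" for l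
    using lam(2)[OF that] by (intro continuous_intros) auto
  then have "continuous_on (sphere 0 1) \<psi>"
    unfolding \<psi>_def by (intro continuous_on_sum continuous_on_mult continuous_on_const) auto
  then have \<phi>: "\<phi> \<in> Linf_circle"
    unfolding \<phi>_def by (intro continuous_on_sphere_Linf_circle continuous_intros continuous_on_\<theta>)
  have "s i j = L2_inner (\<lambda>z. \<phi> z * v j z) (v i)" if ij: "i < n" "j < n" for i j
  proof -
    obtain P where circ: "AE z in circle_measure. v i z * v j z = poly P z / (denom z)\<^sup>2"
      and disc: "\<And>w. norm w < 1 \<Longrightarrow> v i w * v j w = poly P w / (denom w)\<^sup>2"
      by (rule product_extension[OF ij]) blast
    define G where "G = (\<lambda>z. poly P z / (denom z)\<^sup>2)"
    have G: "G \<in> disc_algebra"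
      unfolding G_def by (rule poly_div_denom_square_disc_algebra)
    have "L2_inner (\<lambda>z. \<phi> z * v j z) (v i) = L2_inner (\<lambda>z. \<phi> z * (\<theta> z * cnj z)) G"
      using circ by (intro symbol_entry ij \<phi> disc_algebra_Linf_circle[OF G]) (simp add: G_def)
    also have "\<dots> = L2_inner \<psi> G"
      unfolding L2_inner_def
    proof (rule Bochner_Integration.integral_cong[OF refl])
      fix z assume "z \<in> space circle_measure"
      then have "norm z = 1" by simp
      then have "\<theta> z * cnj (\<theta> z) = 1"
        by (rule \<theta>_unimodular)
      moreover have "z * cnj z = 1"
        using \<open>norm z = 1\<close> by (simp add: complex_norm_square[symmetric])
      moreover have "\<phi> z * (\<theta> z * cnj z) = (\<theta> z * cnj (\<theta> z)) * (z * cnj z) * \<psi> z"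
        by (simp add: \<phi>_def mult_ac)
      ultimately show "\<phi> z * (\<theta> z * cnj z) * cnj (G z) = \<psi> z * cnj (G z)"
        by simp
    qed
    also have "\<dots> = (\<Sum>l<2 * n - 1. \<beta> l * L2_inner (\<lambda>z. cnj (z / (z - lam l))) G)"
      unfolding \<psi>_def
      by (intro L2_inner_sum_left Linf_circle_subset_L2_circle disc_algebra_Linf_circle[OF G]
          continuous_on_sphere_Linf_circle kernel) auto
    also have "\<dots> = (\<Sum>l<2 * n - 1. \<beta> l * cnj (v i (lam l) * v j (lam l)))"
    proof (rule sum.cong[OF refl])
      fix l assume "l \<in> {..<2 * n - 1}"
      then have l: "norm (lam l) < 1" using lam(2) by simp
      have "L2_inner (\<lambda>z. cnj (z / (z - lam l))) G = cnj (LINT z|circle_measure. G z * (z / (z - lam l)))"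
        unfolding L2_inner_def
        by (subst Bochner_Integration.integral_cnj[symmetric]) (simp add: mult.commute)
      also have "\<dots> = cnj (v i (lam l) * v j (lam l))"
        using hardy2_Cauchy_formula[OF disc_algebra_subset_hardy2[OF G] l] disc[OF l]
        by (simp add: G_def)
      finally show "\<beta> l * L2_inner (\<lambda>z. cnj (z / (z - lam l))) G = \<beta> l * cnj (v i (lam l) * v j (lam l))"
        by simp
    qed
    finally show ?thesis using s[OF ij] by simp
  qed
  with \<phi> show "\<exists>\<phi>\<in>Linf_circle. \<forall>i<n. \<forall>j<n. s i j = L2_inner (\<lambda>z. \<phi> z * v j z) (v i)"
    by blast
qed

end

theorem theorem3p3:
  fixes n :: nat
    and \<theta> :: "complex \<Rightarrow> complex"
    and v :: "nat \<Rightarrow> complex \<Rightarrow> complex"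
    and lam :: "nat \<Rightarrow> complex"
    and S :: "complex mat"
  assumes "n \<ge> 1"
    and "blaschke_product n \<theta>"
    and "conj_real_basis n \<theta> v"
    and "\<forall>l<2 * n - 1. lam l \<in> ball 0 1"
    and "inj_on lam {..<2 * n - 1}"
    and "S \<in> carrier_mat n n"
    and "transpose_mat S = S"
  shows "(\<exists>A. truncated_toeplitz \<theta> A \<and> matrix_rep n v A = S) \<longleftrightarrow>
    mat_kernel (mat_of_cols (n * (n + 1) div 2)
      (map (\<lambda>l. vectorialise (eval_matrix n v (lam l))) [0..<2 * n - 1] @ [vectorialise S]))
    \<noteq> {0\<^sub>v (2 * n)}"
proof -
  obtain c a where "norm c = 1" "\<forall>k<n. a k \<in> ball 0 1"
    "\<forall>z\<in>cball 0 1. \<theta> z = c * (\<Prod>k<n. (z - a k) / (1 - cnj (a k) * z))"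
    using assms(2) unfolding blaschke_product_def by blast
  then have "finite_blaschke n \<theta> c a"
    by unfold_locales auto
  then interpret conj_real_model_basis n \<theta> c a v
    using assms(3)
    by (simp add: conj_real_model_basis_def conj_real_model_basis_axioms_def model_basis_def
        model_basis_axioms_def conj_real_basis_def)
  define m where "m = 2 * n - 1"
  have m: "2 * n = Suc m" using assms(1) by (simp add: m_def)
  have lam: "inj_on lam {..<2 * n - 1}" "\<And>l. l < 2 * n - 1 \<Longrightarrow> norm (lam l) < 1"
    using assms(4,5) by auto
  have sym: "S $$ (i, j) = S $$ (j, i)" if "i < n" "j < n" for i j
  proof -
    have "S $$ (i, j) = transpose_mat S $$ (i, j)" using assms(7) by simp
    then show ?thesis using that assms(6) by simp
  qed
  define Ms where "Ms = map (\<lambda>l. eval_matrix n v (lam l)) [0..<m] @ [S]"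
  define N where "N = n * (n + 1) div 2"
  define K where "K = mat_kernel (mat_of_cols N (map vectorialise Ms))"
  have K_eq: "K = mat_kernel (mat_of_cols (n * (n + 1) div 2)
      (map (\<lambda>l. vectorialise (eval_matrix n v (lam l))) [0..<2 * n - 1] @ [vectorialise S]))"
    by (simp add: K_def Ms_def N_def m_def o_def)
  have Ms: "length Ms = 2 * n" "M \<in> set Ms \<Longrightarrow> M \<in> carrier_mat n n" for M
    using assms(6) by (auto simp: Ms_def eval_matrix_def m)
  \<comment> \<open>By symmetry, the relations above the diagonal are all relations.\<close>
  have kernel_iff: "x \<in> K \<longleftrightarrow> x \<in> carrier_vec (2 * n) \<and> (\<forall>i<n. \<forall>j<n.
      (\<Sum>l<m. x $ l * cnj (v i (lam l) * v j (lam l))) + x $ m * S $$ (i, j) = 0)" for x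
  proof (cases "x \<in> carrier_vec (2 * n)")
    case True
    define E where "E = (\<lambda>i j. (\<Sum>l<m. x $ l * cnj (v i (lam l) * v j (lam l))) + x $ m * S $$ (i, j))"
    have E: "(\<Sum>l<length Ms. x $ l * (Ms ! l) $$ (i, j)) = E i j" if "i < n" "j < n" for i j
      using that by (simp add: Ms_def E_def nth_append eval_matrix_def)
    have "x \<in> K \<longleftrightarrow> (\<forall>i j. i \<le> j \<and> j < n \<longrightarrow> (\<Sum>l<length Ms. x $ l * (Ms ! l) $$ (i, j)) = 0)"
      using mat_of_cols_vectorialise_mult_eq_0[OF Ms(2), where x = x] True Ms(1)
      by (simp add: K_def N_def mat_kernel_def)
    also have "\<dots> \<longleftrightarrow> (\<forall>i j. i \<le> j \<and> j < n \<longrightarrow> E i j = 0)"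
      using E by (metis le_less_trans)
    also have "\<dots> \<longleftrightarrow> (\<forall>i<n. \<forall>j<n. E i j = 0)"
    proof -
      have "E i j = E j i" if "i < n" "j < n" for i j
        using sym[OF that] by (simp add: E_def mult.commute)
      then show ?thesis by (metis le_less_trans nat_le_linear)
    qed
    finally show ?thesis using True by (simp add: E_def)
  next
    case False
    then show ?thesis using Ms(1) by (simp add: K_def mat_kernel_def)
  qed
  have "(\<exists>A. truncated_toeplitz \<theta> A \<and> matrix_rep n v A = S) \<longleftrightarrow>
      (\<exists>\<beta>. \<forall>i<n. \<forall>j<n. S $$ (i, j) = (\<Sum>l<m. \<beta> l * cnj (v i (lam l) * v j (lam l))))"
    unfolding matrix_rep_truncated_toeplitz_iff[OF assms(6)] m_def
    by (rule symbol_iff_evaluations[OF lam])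
  also have "\<dots> \<longleftrightarrow> K \<noteq> {0\<^sub>v (2 * n)}"
  proof
    assume "\<exists>\<beta>. \<forall>i<n. \<forall>j<n. S $$ (i, j) = (\<Sum>l<m. \<beta> l * cnj (v i (lam l) * v j (lam l)))"
    then obtain \<beta> where \<beta>: "\<And>i j. i < n \<Longrightarrow> j < n \<Longrightarrow>
        S $$ (i, j) = (\<Sum>l<m. \<beta> l * cnj (v i (lam l) * v j (lam l)))"
      by blast
    define x where "x = Matrix.vec (2 * n) (\<lambda>l. if l < m then \<beta> l else - 1)"
    have "x $ m = - 1" using m by (simp add: x_def)
    moreover have "(\<Sum>l<m. x $ l * cnj (v i (lam l) * v j (lam l)))
        = (\<Sum>l<m. \<beta> l * cnj (v i (lam l) * v j (lam l)))" for i j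
      using m by (intro sum.cong) (auto simp: x_def)
    ultimately have "x \<in> K"
      by (simp only: kernel_iff) (simp add: x_def \<beta>)
    moreover have "x \<noteq> 0\<^sub>v (2 * n)"
      using \<open>x $ m = - 1\<close> m by (metis index_zero_vec(1) lessI neg_equal_0_iff_equal zero_neq_one)
    ultimately show "K \<noteq> {0\<^sub>v (2 * n)}" by blast
  next
    assume "K \<noteq> {0\<^sub>v (2 * n)}"
    moreover have "0\<^sub>v (2 * n) \<in> K"
      using m by (auto simp: kernel_iff)
    ultimately obtain x where "x \<in> K" "x \<noteq> 0\<^sub>v (2 * n)" by blast
    then have x: "x \<in> carrier_vec (2 * n)" and rel: "\<And>i j. i < n \<Longrightarrow> j < n \<Longrightarrow>
        (\<Sum>l<m. x $ l * cnj (v i (lam l) * v j (lam l))) + x $ m * S $$ (i, j) = 0"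
      by (auto simp: kernel_iff)
    \<comment> \<open>Otherwise the kernel vector would be a relation between the evaluation matrices alone.\<close>
    have "x $ m \<noteq> 0"
    proof
      assume "x $ m = 0"
      have "cnj (x $ l) = 0" if "l < m" for l
      proof (rule evaluations_independent[OF lam])
        show "l < 2 * n - 1" using that unfolding m_def .
      next
        fix i j assume "i < n" "j < n"
        then have "cnj (\<Sum>l<m. x $ l * cnj (v i (lam l) * v j (lam l))) = 0"
          using rel \<open>x $ m = 0\<close> by simp
        then show "(\<Sum>l<2 * n - 1. cnj (x $ l) * (v i (lam l) * v j (lam l))) = 0"
          by (simp add: m_def)
      qed
      then have "x = 0\<^sub>v (2 * n)"
        using x \<open>x $ m = 0\<close> m by (intro eq_vecI) (auto simp: less_Suc_eq)
      with \<open>x \<noteq> 0\<^sub>v (2 * n)\<close> show False by contradiction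
    qed
    have "S $$ (i, j) = (\<Sum>l<m. (- x $ l / x $ m) * cnj (v i (lam l) * v j (lam l)))"
      if "i < n" "j < n" for i j
    proof -
      have "S $$ (i, j) = - (\<Sum>l<m. x $ l * cnj (v i (lam l) * v j (lam l))) / x $ m"
        using rel[OF that] \<open>x $ m \<noteq> 0\<close> by (simp add: field_simps add_eq_0_iff)
      then show ?thesis
        by (simp add: sum_divide_distrib sum_negf[symmetric])
    qed
    then show "\<exists>\<beta>. \<forall>i<n. \<forall>j<n. S $$ (i, j) = (\<Sum>l<m. \<beta> l * cnj (v i (lam l) * v j (lam l)))"
      by (intro exI[of _ "\<lambda>l. - x $ l / x $ m"]) blast
  qed
  finally show ?thesis by (simp only: K_eq)
qed

end
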